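(* Let $(x_*(\cdot),u_*(\cdot))$ be an admissible process of the state-constrained problem (QS) (see context) with $x_*(\cdot)\in\mathscr{B}_{\rm Lip}$. Let $p(\cdot):\mathbb{R}_+\to\mathbb{R}^n$ be piecewise continuous with at most countably many jump points $s_k\in(0,\infty)$ that do not accumulate at any finite point, and let $p(\cdot)$ be continuously differentiable between these jumps. Suppose: (a) $p(\cdot)$ is of bounded variation and there exist nonnegative regular Borel measures $\mu_j$ on $[0,\infty]$ of finite total variation, $\mu_j$ concentrated on $T_j=\{t\in[0,\infty]:g_j(t,x_*(t))=0\}$, $j=1,\dots,l$, and a vector $q\in\mathbb{R}^n$ with $q_i=0$ for all $i\notin I_1$, such that for all $t\in\mathbb{R}_+$ $$p(t)=q+\int_t^\infty H_x(s,x_*(s),u_*(s),p(s),1)\,ds-\sum_{j=1}^l\int_{[t,\infty]}g_{jx}(s,x_*(s))\,d\mu_j(s),$$ $p_i(0)=0$ for all $i\notin I_0$, and for almost every $t\in\mathbb{R}_+$ $$H(t,x_*(t),u_*(t),p(t),1)=\max_{u\in U}H(t,x_*(t),u,p(t),1).$$ (b) There is $\gamma>0$ such that for every $t\in\mathbb{R}_+$ the function $x\mapsto\mathscr{H}(t,x,p(t))$ is concave and the functions $x\mapsto g_j(t,x)$, $j=1,\dots,l$, are convex on $V_\gamma(t)=\{x\in\mathbb{R}^n:\|x-x_*(t)\|\le\gamma\}$. Then $(x_*(\cdot),u_*(\cdot))$ is a strong local minimum of problem (QS).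
   Context: $\mathbb{R}_+=[0,\infty)$, $\overline{\mathbb{R}}_+=[0,\infty]$. $W^1_\infty(\mathbb{R}_+,\mathbb{R}^n)$ is the space of bounded functions, absolutely continuous on compact intervals, with essentially bounded derivative. $L_\infty(\mathbb{R}_+,U)$ is the set of essentially bounded measurable functions with values in $U$. Problem (QS): $$J(x(\cdot),u(\cdot))=\int_0^\infty\omega(t)f(t,x(t),u(t))\,dt\to\inf,\quad \dot x(t)=\varphi(t,x(t),u(t)),\quad x(0)=x_0,\quad \lim_{t\to\infty}x(t)=x_1,$$ $$u(t)\in U,\qquad g_j(t,x(t))\le0\ \text{ for all }t\in\mathbb{R}_+,\ j=1,\dots,l,$$ with $\emptyset\ne U\subseteq\mathbb{R}^m$, $\omega(\cdot)\in L_1(\mathbb{R}_+,\mathbb{R}_+)$, $f:\mathbb{R}\times\mathbb{R}^n\times\mathbb{R}^m\to\mathbb{R}$, $\varphi:\mathbb{R}\times\mathbb{R}^n\times\mathbb{R}^m\to\mathbb{R}^n$, $g_j:\mathbb{R}\times\mathbb{R}^n\to\mathbb{R}$. Some components of $x_0$ and $x_1$ may be left free: $I_0,I_1\subseteq\{1,\dots,n\}$ denote the sets of prescribed components, so the boundary conditions read $x_i(0)=x_{0,i}$ for $i\in I_0$ and $\lim_{t\to\infty}x_i(t)=x_{1,i}$ for $i\in I_1$, the other components being unrestricted. A process $(x(\cdot),u(\cdot))\in W^1_\infty(\mathbb{R}_+,\mathbb{R}^n)\times L_\infty(\mathbb{R}_+,U)$ is admissible if $x(\cdot)$ solves the differential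 equation on every finite interval in the sense of Carathéodory, the boundary conditions and state constraints hold, and the Lebesgue integral $J(x(\cdot),u(\cdot))$ is finite. An admissible $(x_*(\cdot),u_*(\cdot))$ is a strong local minimum if there is $\varepsilon>0$ such that $J(x(\cdot),u(\cdot))\ge J(x_*(\cdot),u_*(\cdot))$ for all admissible $(x(\cdot),u(\cdot))$ with $\|x(\cdot)-x_*(\cdot)\|_\infty\le\varepsilon$. $x_*(\cdot)\in\mathscr{B}_{\rm Lip}$ means that $x_*(\cdot)\in W^1_\infty(\mathbb{R}_+,\mathbb{R}^n)$ and for every compact $U_1\subseteq\mathbb{R}^m$ there is $\gamma>0$ such that on $V_\gamma\times U_1$, $V_\gamma=\{(t,x):\|x-x_*(t)\|\le\gamma\}$, the maps $f(t,x,u)$, $\varphi(t,x,u)$, $g_j(t,x)$ are uniformly continuous and differentiable in $x$ with uniformly continuous $x$-derivatives. Here $t$ ranges over $\overline{\mathbb{R}}_+$; concretely, uniform continuity on the points of $V_\gamma$ with $t<\infty$ is meant with respect to a metric of the compact space $[0,\infty]$ in $t$ (e.g. $|\arctan t-\arctan s|$) and the Euclidean metric in $x,u$. Values of $g_j(t,x_*(t))$ and $g_{jx}(t,x_*(t))$ at $t=\infty$ are the limits as $t\to\infty$; $\infty\in T_j$ means $\lim_{t\to\infty}g_j(t,x_*(t))=0$, and if $\mu_j(\{\infty\})>0$ the limit of $g_{jx}(t,x_*(t))$ is understood to exist. Pontryagin function: $H(t,x,u,p,\lambda_0)=\langle p,\varphi(t,x,u)\rangle-\lambda_0\,\omega(t)f(t,x,u)$,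 with $x$-gradient $H_x$. Hamiltonian (normal case): $\mathscr{H}(t,x,p)=\sup_{u\in U}H(t,x,u,p,1)$. *)

theory Defs
  imports "HOL-Analysis.Analysis"
begin

text \<open>
  The interval of nonnegative extended reals is the type \<^typ>\<open>ennreal\<close>; functions of time have
  type \<^typ>\<open>real\<close> \<open>\<Rightarrow>\<close> \<open>_\<close> and only their values at nonnegative arguments matter.  The state
  constraints are \<open>g j\<close> with \<open>j \<in> {1..l}\<close>; the case \<open>l = 0\<close> (no state constraint) is included.
\<close>


text \<open>A division is a finite family of nonoverlapping compact intervals \<open>[Inf k, Sup k]\<close>.\<close>

definition abs_cont_on :: "real set \<Rightarrow> (real \<Rightarrow> 'a::real_normed_vector) \<Rightarrow> bool" where
  "abs_cont_on S x \<longleftrightarrow>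
     (\<forall>\<epsilon>>0. \<exists>\<delta>>0. \<forall>\<D>. \<D> division_of \<Union>\<D> \<and> \<Union>\<D> \<subseteq> S \<and> (\<Sum>k\<in>\<D>. Sup k - Inf k) < \<delta>
        \<longrightarrow> (\<Sum>k\<in>\<D>. norm (x (Sup k) - x (Inf k))) < \<epsilon>)"

definition bounded_variation_on :: "real set \<Rightarrow> (real \<Rightarrow> 'a::real_normed_vector) \<Rightarrow> bool" where
  "bounded_variation_on S p \<longleftrightarrow>
     (\<exists>B. \<forall>\<D>. \<D> division_of \<Union>\<D> \<and> \<Union>\<D> \<subseteq> S
        \<longrightarrow> (\<Sum>k\<in>\<D>. norm (p (Sup k) - p (Inf k))) \<le> B)"

definition W1_inf :: "(real \<Rightarrow> real^'n) set" where
  "W1_inf = {x. bounded (x ` {0..}) \<and>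
                (\<forall>a b. 0 \<le> a \<longrightarrow> abs_cont_on {a..b} x) \<and>
                (\<exists>M. AE t in lebesgue_on {0..}. \<exists>v. (x has_vector_derivative v) (at t) \<and> norm v \<le> M)}"

definition L_inf :: "(real^'m) set \<Rightarrow> (real \<Rightarrow> real^'m) set" where
  "L_inf U = {u. u \<in> borel_measurable (lebesgue_on {0..}) \<and>
                 (\<exists>M. AE t in lebesgue_on {0..}. norm (u t) \<le> M) \<and>
                 (\<forall>t\<ge>0. u t \<in> U)}"

definition sup_norm :: "(real \<Rightarrow> real^'n) \<Rightarrow> real" where
  "sup_norm x = (SUP t\<in>{0..}. norm (x t))"


definition QS_cost ::
  "(real \<Rightarrow> real) \<Rightarrow> (real \<Rightarrow> real^'n \<Rightarrow> real^'m \<Rightarrow> real) \<Rightarrow>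
   (real \<Rightarrow> real^'n) \<Rightarrow> (real \<Rightarrow> real^'m) \<Rightarrow> real" where
  "QS_cost \<omega> f x u = (LINT t:{0..}|lebesgue. \<omega> t * f t (x t) (u t))"

text \<open>
  In the data of the problem, \<open>I0\<close> and \<open>I1\<close> are the sets of prescribed components of the initial
  value and of the limit at infinity.  The remaining components of \<open>x0\<close> and \<open>x1\<close> are not used.
\<close>

definition QS_admissible ::
  "(real^'m) set \<Rightarrow> (real \<Rightarrow> real) \<Rightarrow> (real \<Rightarrow> real^'n \<Rightarrow> real^'m \<Rightarrow> real) \<Rightarrow>
   (real \<Rightarrow> real^'n \<Rightarrow> real^'m \<Rightarrow> real^'n) \<Rightarrow> nat \<Rightarrow> (nat \<Rightarrow> real \<Rightarrow> real^'n \<Rightarrow> real) \<Rightarrow>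
   'n set \<Rightarrow> 'n set \<Rightarrow> real^'n \<Rightarrow> real^'n \<Rightarrow>
   (real \<Rightarrow> real^'n) \<Rightarrow> (real \<Rightarrow> real^'m) \<Rightarrow> bool" where
  "QS_admissible U \<omega> f \<phi> l g I0 I1 x0 x1 x u \<longleftrightarrow>
     x \<in> W1_inf \<and> u \<in> L_inf U \<and>
     (AE t in lebesgue_on {0..}. (x has_vector_derivative \<phi> t (x t) (u t)) (at t)) \<and>
     (\<forall>i\<in>I0. x 0 $ i = x0 $ i) \<and>
     (\<forall>i\<in>I1. ((\<lambda>t. x t $ i) \<longlongrightarrow> x1 $ i) at_top) \<and>
     (\<forall>j\<in>{1..l}. \<forall>t\<ge>0. g j t (x t) \<le> 0) \<and>
     set_integrable lebesgue {0..} (\<lambda>t. \<omega> t * f t (x t) (u t))"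

definition QS_strong_local_minimum ::
  "(real^'m) set \<Rightarrow> (real \<Rightarrow> real) \<Rightarrow> (real \<Rightarrow> real^'n \<Rightarrow> real^'m \<Rightarrow> real) \<Rightarrow>
   (real \<Rightarrow> real^'n \<Rightarrow> real^'m \<Rightarrow> real^'n) \<Rightarrow> nat \<Rightarrow> (nat \<Rightarrow> real \<Rightarrow> real^'n \<Rightarrow> real) \<Rightarrow>
   'n set \<Rightarrow> 'n set \<Rightarrow> real^'n \<Rightarrow> real^'n \<Rightarrow>
   (real \<Rightarrow> real^'n) \<Rightarrow> (real \<Rightarrow> real^'m) \<Rightarrow> bool" where
  "QS_strong_local_minimum U \<omega> f \<phi> l g I0 I1 x0 x1 xs us \<longleftrightarrow>
     QS_admissible U \<omega> f \<phi> l g I0 I1 x0 x1 xs us \<and>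
     (\<exists>\<epsilon>>0. \<forall>x u. QS_admissible U \<omega> f \<phi> l g I0 I1 x0 x1 x u \<and>
                     sup_norm (\<lambda>t. x t - xs t) \<le> \<epsilon>
              \<longrightarrow> QS_cost \<omega> f x u \<ge> QS_cost \<omega> f xs us)"


text \<open>
  Uniform continuity with respect to \<open>\<bar>arctan t - arctan s\<bar>\<close> in the time variable, a metric of
  the compact space \<open>[0,\<infinity>]\<close>, and the Euclidean metric in the remaining variables.
\<close>

definition ext_uniformly_continuous_on ::
  "(real \<times> 'a::metric_space \<times> 'b::metric_space) set \<Rightarrow> (real \<Rightarrow> 'a \<Rightarrow> 'b \<Rightarrow> 'c::metric_space) \<Rightarrow> bool" where
  "ext_uniformly_continuous_on S h \<longleftrightarrow>
     (\<forall>\<epsilon>>0. \<exists>\<delta>>0. \<forall>(t,x,u)\<in>S. \<forall>(s,y,v)\<in>S.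
        \<bar>arctan t - arctan s\<bar> < \<delta> \<and> dist x y < \<delta> \<and> dist u v < \<delta>
        \<longrightarrow> dist (h t x u) (h s y v) < \<epsilon>)"

definition ext_uniformly_C1x_on ::
  "(real \<times> 'a::real_normed_vector \<times> 'b::metric_space) set \<Rightarrow>
   (real \<Rightarrow> 'a \<Rightarrow> 'b \<Rightarrow> 'c::real_normed_vector) \<Rightarrow> bool" where
  "ext_uniformly_C1x_on S h \<longleftrightarrow>
     ext_uniformly_continuous_on S h \<and>
     (\<exists>h' :: real \<Rightarrow> 'a \<Rightarrow> 'b \<Rightarrow> ('a \<Rightarrow>\<^sub>L 'c).
        (\<forall>(t,x,u)\<in>S. ((\<lambda>y. h t y u) has_derivative blinfun_apply (h' t x u)) (at x)) \<and>
        ext_uniformly_continuous_on S h')"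

definition B_Lip ::
  "(real \<Rightarrow> real^'n \<Rightarrow> real^'m \<Rightarrow> real) \<Rightarrow> (real \<Rightarrow> real^'n \<Rightarrow> real^'m \<Rightarrow> real^'n) \<Rightarrow>
   nat \<Rightarrow> (nat \<Rightarrow> real \<Rightarrow> real^'n \<Rightarrow> real) \<Rightarrow> (real \<Rightarrow> real^'n) set" where
  "B_Lip f \<phi> l g =
     {xs \<in> W1_inf. \<forall>U1. compact U1 \<longrightarrow>
        (\<exists>\<gamma>>0. let S = {(t,x,u). 0 \<le> t \<and> norm (x - xs t) \<le> \<gamma> \<and> u \<in> U1} in
           ext_uniformly_C1x_on S f \<and> ext_uniformly_C1x_on S \<phi> \<and>
           (\<forall>j\<in>{1..l}. ext_uniformly_C1x_on S (\<lambda>t x u. g j t x)))}"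


text \<open>The gradient is unspecified where the function is not differentiable.\<close>

definition gradient :: "('a::real_inner \<Rightarrow> real) \<Rightarrow> 'a \<Rightarrow> 'a" where
  "gradient F x = (THE D. GDERIV F x :> D)"

definition pontryagin ::
  "(real \<Rightarrow> real) \<Rightarrow> (real \<Rightarrow> real^'n \<Rightarrow> real^'m \<Rightarrow> real) \<Rightarrow>
   (real \<Rightarrow> real^'n \<Rightarrow> real^'m \<Rightarrow> real^'n) \<Rightarrow>
   real \<Rightarrow> real^'n \<Rightarrow> real^'m \<Rightarrow> real^'n \<Rightarrow> real \<Rightarrow> real" where
  "pontryagin \<omega> f \<phi> t x u p c0 = p \<bullet> \<phi> t x u - c0 * \<omega> t * f t x u"

definition pontryagin_x ::
  "(real \<Rightarrow> real) \<Rightarrow> (real \<Rightarrow> real^'n \<Rightarrow> real^'m \<Rightarrow> real) \<Rightarrow>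
   (real \<Rightarrow> real^'n \<Rightarrow> real^'m \<Rightarrow> real^'n) \<Rightarrow>
   real \<Rightarrow> real^'n \<Rightarrow> real^'m \<Rightarrow> real^'n \<Rightarrow> real \<Rightarrow> real^'n" where
  "pontryagin_x \<omega> f \<phi> t x u p c0 = gradient (\<lambda>y. pontryagin \<omega> f \<phi> t y u p c0) x"

text \<open>The supremum over the controls may be \<open>+\<infinity>\<close>.\<close>

definition hamiltonian ::
  "(real^'m) set \<Rightarrow> (real \<Rightarrow> real) \<Rightarrow> (real \<Rightarrow> real^'n \<Rightarrow> real^'m \<Rightarrow> real) \<Rightarrow>
   (real \<Rightarrow> real^'n \<Rightarrow> real^'m \<Rightarrow> real^'n) \<Rightarrow> real \<Rightarrow> real^'n \<Rightarrow> real^'n \<Rightarrow> ereal" where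
  "hamiltonian U \<omega> f \<phi> t x p = (SUP u\<in>U. ereal (pontryagin \<omega> f \<phi> t x u p 1))"

text \<open>
  Concavity for functions with values in \<open>(-\<infinity>,+\<infinity>]\<close>.  As \<open>-\<infinity>\<close> does not occur, the left-hand
  side is never of the form \<open>\<infinity> - \<infinity>\<close>; moreover \<open>0 \<cdot> \<infinity> = 0\<close> in \<^typ>\<open>ereal\<close>.
\<close>

definition ereal_concave_on :: "'a::real_vector set \<Rightarrow> ('a \<Rightarrow> ereal) \<Rightarrow> bool" where
  "ereal_concave_on S F \<longleftrightarrow>
     convex S \<and>
     (\<forall>x\<in>S. \<forall>y\<in>S. \<forall>a\<ge>0. \<forall>b\<ge>0. a + b = 1 \<longrightarrow>
        ereal a * F x + ereal b * F y \<le> F (a *\<^sub>R x + b *\<^sub>R y))"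


text \<open>
  \<open>J\<close> is the set of jump points.  Between jumps the derivative is required on open intervals
  only; at the left end point \<open>0\<close> just (one-sided) continuity is asked for.
\<close>

definition piecewise_C1 :: "(real \<Rightarrow> real^'n) \<Rightarrow> bool" where
  "piecewise_C1 p \<longleftrightarrow>
     (\<exists>J. J \<subseteq> {0<..} \<and> countable J \<and> (\<forall>t. \<not> t islimpt J) \<and>
          continuous_on ({0..} - J) p \<and>
          (\<forall>s\<in>J. (\<exists>a. (p \<longlongrightarrow> a) (at_left s)) \<and> (\<exists>b. (p \<longlongrightarrow> b) (at_right s))) \<and>
          p C1_differentiable_on ({0<..} - J))"

definition finite_regular_borel_measure :: "'a::topological_space measure \<Rightarrow> bool" where
  "finite_regular_borel_measure M \<longleftrightarrow>
     sets M = sets borel \<and> finite_measure M \<and>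
     (\<forall>B\<in>sets borel.
        emeasure M B = (SUP K\<in>{K. compact K \<and> K \<in> sets borel \<and> K \<subseteq> B}. emeasure M K) \<and>
        emeasure M B = (INF V\<in>{V. open V \<and> B \<subseteq> V}. emeasure M V))"

text \<open>
  Extension of a function on the half-line to \<open>[0,\<infinity>]\<close> by its limit at \<open>\<infinity>\<close>; if that limit does
  not exist, the value at \<open>\<infinity>\<close> is unspecified.
\<close>

definition ext_value :: "(real \<Rightarrow> 'a::t2_space) \<Rightarrow> ennreal \<Rightarrow> 'a" where
  "ext_value h s = (if s = \<infinity> then Lim at_top h else h (enn2real s))"

definition active_set :: "(real \<Rightarrow> real^'n \<Rightarrow> real) \<Rightarrow> (real \<Rightarrow> real^'n) \<Rightarrow> ennreal set" where
  "active_set gj x =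
     {s. if s = \<infinity> then ((\<lambda>t. gj t (x t)) \<longlongrightarrow> 0) at_top
         else gj (enn2real s) (x (enn2real s)) = 0}"

end

theory Submission
  imports Defs
begin

text \<open>
  Let \<open>h = x - xs\<close> for an admissible competitor \<open>(x, u)\<close> close to \<open>(xs, us)\<close>, and \<open>\<eta>\<close> the \<open>x\<close>-gradient
  of the Pontryagin function along \<open>(xs, us)\<close>.  By the maximum condition this function touches the
  concave Hamiltonian from below at \<open>xs t\<close>, so \<open>\<eta> t\<close> is a supergradient of the Hamiltonian there;
  hence the difference of the cost densities is at least \<open>p \<bullet> h' - \<eta> \<bullet> h\<close> almost everywhere.
  Inserting the integral representation of \<open>p\<close> and exchanging the integrals over \<open>[0, T]\<close> leaves
  boundary terms that vanish as \<open>T \<rightarrow> \<infinity>\<close> by the transversality conditions, and the terms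
  \<open>- \<integral> g_jx(s, xs s) \<bullet> h(min s T) d\<mu>_j(s)\<close>, whose lower limit is nonnegative since each \<open>g_j\<close> is convex,
  at most \<open>0\<close> along \<open>x\<close> and equal to \<open>0\<close> along \<open>xs\<close> on the support of \<open>\<mu>_j\<close>.
\<close>

section \<open>Absolutely continuous functions\<close>

lemma abs_cont_imp_has_integral:
  fixes f :: "real \<Rightarrow> 'a::euclidean_space"
  assumes ac: "abs_cont_on {a..b} f" and ab: "a \<le> b" and N: "negligible N"
    and deriv: "\<And>t. t \<in> {a..b} - N \<Longrightarrow> (f has_vector_derivative f' t) (at t)"
  shows "(f' has_integral (f b - f a)) {a..b}"
  \<comment> \<open>The gauge confines the intervals tagged in \<open>N\<close> to an open set \<open>W\<close> of small measure, so that absolute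
    continuity bounds their contribution.\<close>
proof -
  \<comment> \<open>With the derivative set to \<open>0\<close> on \<open>N\<close>, an interval
    tagged there contributes only its increment of \<open>f\<close>. Values on a negligible set do
    not affect the integral, so \<open>f'\<close> is restored at the end.\<close>
  define k where "k t = (if t \<in> N then 0 else f' t)" for t
  have "(k has_integral (f b - f a)) {a..b}"
    unfolding has_integral_real
  proof (intro allI impI)
    fix e :: real
    assume e: "e > 0"
    obtain \<delta> where \<delta>: "\<delta> > 0"
      and small: "\<And>\<D>. \<D> division_of \<Union>\<D> \<Longrightarrow> \<Union>\<D> \<subseteq> {a..b} \<Longrightarrow> (\<Sum>k\<in>\<D>. Sup k - Inf k) < \<delta>
          \<Longrightarrow> (\<Sum>k\<in>\<D>. norm (f (Sup k) - f (Inf k))) < e / 2"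
      using ac e unfolding abs_cont_on_def by (meson half_gt_zero)
    have "N \<in> sets lebesgue"
      using N by (simp add: negligible_imp_sets)
    then obtain W where W: "open W" "N \<subseteq> W" "W - N \<in> lmeasurable" "emeasure lebesgue (W - N) < ennreal \<delta>"
      using sets_lebesgue_outer_open \<delta> by metis
    have Wm: "W \<in> lmeasurable" "measure lebesgue W < \<delta>"
    proof -
      have WN: "W = (W - N) \<union> (W \<inter> N)" by auto
      have "negligible (W \<inter> N)" by (rule negligible_subset[OF N]) auto
      then have i: "W \<inter> N \<in> lmeasurable" "measure lebesgue (W \<inter> N) = 0"
        by (auto simp: negligible_imp_measurable negligible_imp_measure0)
      show "W \<in> lmeasurable" using WN W(3) i(1) by (metis fmeasurable.Un)
      have "measure lebesgue W \<le> measure lebesgue (W - N) + measure lebesgue (W \<inter> N)"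
        using WN W(3) i(1) by (metis measure_Un_le fmeasurableD)
      moreover have "measure lebesgue (W - N) < \<delta>"
        using W(3,4) \<delta> by (metis emeasure_eq_measure2 ennreal_less_iff measure_nonneg)
      ultimately show "measure lebesgue W < \<delta>" using i by simp
    qed
    \<comment> \<open>A slope error \<open>c\<close> per unit length costs at most
      \<open>e / 2\<close> over \<open>{a..b}\<close>; the \<open>+ 1\<close> keeps the denominator
      positive when \<open>a = b\<close>.\<close>
    define c where "c = e / (2 * (b - a + 1))"
    have c: "c > 0" "c * (b - a) \<le> e / 2"
      using e ab by (auto simp: c_def field_simps)
    have "\<exists>d>0. t \<in> {a..b} - N \<longrightarrow>
         (\<forall>y. norm (y-t) < d \<longrightarrow> norm (f y - f t - (y-t) *\<^sub>R k t) \<le> c * norm (y-t))" for t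
    proof (cases "t \<in> {a..b} - N")
      case True
      then have "(f has_vector_derivative k t) (at t)" using deriv by (simp add: k_def)
      then show ?thesis
        using c(1) unfolding has_vector_derivative_def has_derivative_at_alt by blast
    qed (use zero_less_one in blast)
    then obtain d where d: "\<And>t. 0 < d t"
      and dd: "\<And>t y. \<lbrakk>t \<in> {a..b} - N; norm (y-t) < d t\<rbrakk>
                        \<Longrightarrow> norm (f y - f t - (y-t) *\<^sub>R k t) \<le> c * norm (y-t)"
      by metis
    have gauge: "gauge (\<lambda>t. if t \<in> N then W else ball t (d t))"
      using W(1,2) d by (auto simp: gauge_def)
    have close: "norm ((\<Sum>(x, K)\<in>p. measure lborel K *\<^sub>R k x) - (f b - f a)) < e"
      if ptag: "p tagged_division_of {a..b}" and fine: "(\<lambda>t. if t \<in> N then W else ball t (d t)) fine p" for p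
    proof -
      let ?r = "\<lambda>(x, K). measure lborel K *\<^sub>R k x - (f (Sup K) - f (Inf K))"
      have fin: "finite p" using ptag by auto
      have K: "\<exists>u v. K = {u..v} \<and> u \<le> v \<and> x \<in> {u..v} \<and> a \<le> u \<and> v \<le> b" if xK: "(x,K) \<in> p" for x K
      proof -
        obtain u v where uv: "K = {u..v}"
          using tagged_division_ofD(4)[OF ptag xK] by auto
        have "x \<in> K" "K \<subseteq> {a..b}"
          using tagged_division_ofD(2,3)[OF ptag xK] by auto
        then show ?thesis using uv by (intro exI[of _ u] exI[of _ v]) auto
      qed
      have "f b - f a = (\<Sum>(x,K)\<in>p. f(Sup K) - f(Inf K))"
        using additive_tagged_division_1[OF ab ptag, of f] by simp
      then have "(\<Sum>(x, K)\<in>p. measure lborel K *\<^sub>R k x) - (f b - f a) = sum ?r p"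
        by (simp add: sum_subtractf[symmetric] case_prod_unfold)
      also have "norm \<dots> \<le> (\<Sum>z\<in>p. norm (?r z))" by (rule norm_sum)
      also have "\<dots> = (\<Sum>z\<in>{z\<in>p. fst z \<notin> N}. norm (?r z)) + (\<Sum>z\<in>{z\<in>p. fst z \<in> N}. norm (?r z))"
        using fin by (subst sum.union_disjoint[symmetric]) (auto intro!: sum.cong)
      also have "\<dots> < e / 2 + e / 2"
      proof (rule add_le_less_mono)
        have "(\<Sum>z\<in>{z\<in>p. fst z \<notin> N}. norm (?r z)) \<le> (\<Sum>z\<in>{z\<in>p. fst z \<notin> N}. c * (Sup (snd z) - Inf (snd z)))"
        proof (rule sum_mono)
          fix z assume z: "z \<in> {z\<in>p. fst z \<notin> N}"
          obtain x K where zxK: "z = (x,K)" by (rule prod.exhaust)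
          with z have xK: "(x,K) \<in> p" and xN: "x \<notin> N" by auto
          obtain u v where uv: "K = {u..v}" "u \<le> v" "x \<in> {u..v}" "a \<le> u" "v \<le> b" using K[OF xK] by blast
          have "K \<subseteq> ball x (d x)" using fine xK xN by (fastforce simp: fine_def)
          moreover have "u \<in> K" "v \<in> K" using uv by auto
          ultimately have near: "norm (u - x) < d x" "norm (v - x) < d x"
            by (auto simp: subset_eq dist_norm norm_minus_commute)
          have x: "x \<in> {a..b} - N" using uv xN by auto
          \<comment> \<open>Both endpoint errors are measured from the tag \<open>x\<close>; as
            \<open>u \<le> x \<le> v\<close>, the two bounds add up to the length of the
            interval.\<close>
          have "norm ((v - u) *\<^sub>R k x - (f v - f u)) = norm ((f u - f x - (u - x) *\<^sub>R k x) - (f v - f x - (v - x) *\<^sub>R k x))"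
            by (simp add: algebra_simps)
          also have "\<dots> \<le> c * norm (u - x) + c * norm (v - x)"
            by (rule order_trans[OF norm_triangle_ineq4]) (intro add_mono dd x near)
          also have "\<dots> = c * (v - u)" using uv by (auto simp: algebra_simps)
          finally show "norm (?r z) \<le> c * (Sup (snd z) - Inf (snd z))"
            using uv by (simp add: zxK)
        qed
        also have "\<dots> \<le> (\<Sum>z\<in>p. c * (Sup (snd z) - Inf (snd z)))"
          using c(1) by (intro sum_mono2 fin) (auto dest!: K)
        also have "\<dots> = c * (b - a)"
          using additive_tagged_division_1[OF ab ptag, of "\<lambda>x. x"]
          by (simp add: sum_distrib_left[symmetric] case_prod_unfold)
        finally show "(\<Sum>z\<in>{z\<in>p. fst z \<notin> N}. norm (?r z)) \<le> e / 2" using c(2) by linarith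
      next
        let ?q = "{z\<in>p. fst z \<in> N}"
        have q: "?q tagged_partial_division_of {a..b}"
          using ptag unfolding tagged_division_of_def by (rule tagged_partial_division_subset[OF conjunct1]) auto
        have div: "(snd ` ?q) division_of \<Union>(snd ` ?q)"
          by (rule partial_division_of_tagged_division[OF q])
        have sub: "\<Union>(snd ` ?q) \<subseteq> {a..b}"
          using tagged_division_ofD(3)[OF ptag] by fastforce
        have subW: "\<Union>(snd ` ?q) \<subseteq> W" using fine by (fastforce simp: fine_def)
        \<comment> \<open>The intervals do not overlap, so their total length is the measure of
          their union, which lies in \<open>W\<close>.\<close>
        have "(\<Sum>K\<in>snd ` ?q. Sup K - Inf K) = (\<Sum>K\<in>snd ` ?q. measure lebesgue K)"
          by (rule sum.cong) (auto dest!: K)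
        also have "\<dots> = measure lebesgue (\<Union>(snd ` ?q))"
          using content_division[OF div] by simp
        also have "\<dots> \<le> measure lebesgue W"
          using subW Wm div by (intro measure_mono_fmeasurable) (auto dest: lmeasurable_division)
        also have "\<dots> < \<delta>" by (rule Wm)
        finally have *: "(\<Sum>K\<in>snd ` ?q. norm (f (Sup K) - f (Inf K))) < e / 2"
          by (intro small div sub)
        \<comment> \<open>Passing from tagged pairs to the set of intervals merges pairs that share
          an interval, which is harmless if degenerate intervals contribute \<open>0\<close>. As
          \<open>Sup {}\<close> and \<open>Inf {}\<close> are unspecified, the empty interval gets
          this value explicitly.\<close>
        let ?d = "\<lambda>K. if K = {} then 0 else norm (f (Sup K) - f (Inf K))"
        have "(\<Sum>z\<in>?q. norm (?r z)) = (\<Sum>(x,K)\<in>?q. ?d K)"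
          by (rule sum.cong) (auto simp: k_def norm_minus_commute dest!: K)
        also have "\<dots> = sum ?d (snd ` ?q)"
          by (rule sum.over_tagged_division_lemma[OF tagged_partial_division_of_Union_self[OF q]])
            auto
        also have "\<dots> = (\<Sum>K\<in>snd ` ?q. norm (f (Sup K) - f (Inf K)))"
          by (rule sum.cong) (auto dest!: K)
        finally show "(\<Sum>z\<in>?q. norm (?r z)) < e / 2" using * by simp
      qed
      finally show ?thesis by simp
    qed
    show "\<exists>\<gamma>. gauge \<gamma> \<and> (\<forall>\<D>. \<D> tagged_division_of {a..b} \<and> \<gamma> fine \<D> \<longrightarrow>
        norm ((\<Sum>(x, K)\<in>\<D>. measure lborel K *\<^sub>R k x) - (f b - f a)) < e)"
    proof (intro exI conjI allI impI)
      show "gauge (\<lambda>t. if t \<in> N then W else ball t (d t))" by (rule gauge)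
    qed (use close in blast)
  qed
  then show ?thesis
    by (rule has_integral_spike[OF N, rotated]) (simp add: k_def)
qed

lemma abs_cont_on_imp_continuous_on:
  assumes "abs_cont_on {a..b} x"
  shows "continuous_on {a..b} x"
  unfolding continuous_on_iff
proof (intro ballI allI impI)
  fix t e :: real
  assume t: "t \<in> {a..b}" and e: "0 < e"
  obtain \<delta> where \<delta>: "\<delta> > 0"
    and small: "\<And>\<D>. \<D> division_of \<Union>\<D> \<Longrightarrow> \<Union>\<D> \<subseteq> {a..b} \<Longrightarrow> (\<Sum>k\<in>\<D>. Sup k - Inf k) < \<delta>
      \<Longrightarrow> (\<Sum>k\<in>\<D>. norm (x (Sup k) - x (Inf k))) < e"
    using assms e unfolding abs_cont_on_def by meson
  have *: "dist (x r) (x s) < e" if "r \<in> {a..b}" "s \<in> {a..b}" "r \<le> s" "s - r < \<delta>" for r s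
    using small[of "{{r..s}}"] that division_of_self[of r s] by (simp add: dist_norm norm_minus_commute)
  have "dist (x s) (x t) < e" if "s \<in> {a..b}" "dist s t < \<delta>" for s
  proof (cases "s \<le> t")
    case True
    then show ?thesis using *[of s t] t that by (simp add: dist_real_def)
  next
    case False
    then show ?thesis using *[of t s] t that by (simp add: dist_real_def dist_commute)
  qed
  then show "\<exists>d>0. \<forall>s\<in>{a..b}. dist s t < d \<longrightarrow> dist (x s) (x t) < e"
    using \<delta> by blast
qed

lemma W1_inf_continuous_on:
  assumes "x \<in> W1_inf"
  shows "continuous_on {0..} x"
proof (rule continuous_on_eq_continuous_within[THEN iffD2], intro ballI)
  fix t :: real assume t: "t \<in> {0..}"
  have "abs_cont_on {0..t + 1} x" using assms unfolding W1_inf_def by blast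
  then have "continuous_on {0..t + 1} x" by (rule abs_cont_on_imp_continuous_on)
  then have "continuous (at t within {0..t + 1}) x"
    using t by (simp add: continuous_on_eq_continuous_within)
  moreover have "at t within {0..t + 1} = at t within {0..}"
    by (rule at_within_nhd[of _ "{..<t + 1}"]) auto
  ultimately show "continuous (at t within {0..}) x" by simp
qed

text \<open>The derivative, which exists and is bounded almost everywhere, is replaced by a version
  bounded at every point. Absolute continuity makes \<open>x\<close> its primitive, and the uniform
  bound later serves as the majorant for Fubini's theorem.\<close>

lemma W1_inf_derivative:
  assumes "x \<in> W1_inf"
  obtains k M where "\<And>t. norm (k t) \<le> M"
    "AE t in lebesgue_on {0..}. (x has_vector_derivative k t) (at t)"
    "\<And>T. 0 \<le> T \<Longrightarrow> (k has_integral x T - x 0) {0..T}"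
proof -
  obtain M where M: "AE t in lebesgue_on {0..}. \<exists>v. (x has_vector_derivative v) (at t) \<and> norm v \<le> M"
    using assms unfolding W1_inf_def by auto
  define P where "P t \<longleftrightarrow> (\<exists>v. (x has_vector_derivative v) (at t) \<and> norm v \<le> M)" for t
  define k where "k t = (if P t then vector_derivative x (at t) else 0)" for t
  have k: "(x has_vector_derivative k t) (at t)" "norm (k t) \<le> M" if "P t" for t
    using that by (auto simp: P_def k_def vector_derivative_at)
  have AE: "AE t in lebesgue. 0 \<le> t \<longrightarrow> P t"
    using M by (simp add: AE_restrict_space_iff P_def)
  then obtain N where N: "{t \<in> space lebesgue. \<not> (0 \<le> t \<longrightarrow> P t)} \<subseteq> N" "N \<in> null_sets lebesgue"
    unfolding eventually_ae_filter by blast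
  show thesis
  proof
    \<comment> \<open>On the exceptional set \<open>k\<close> is \<open>0\<close>, and
      \<open>M\<close> itself might be negative, hence the absolute value.\<close>
    show "norm (k t) \<le> \<bar>M\<bar>" for t
      using k(2)[of t] by (cases "P t") (auto simp: k_def)
    show "AE t in lebesgue_on {0..}. (x has_vector_derivative k t) (at t)"
    proof -
      have "AE t in lebesgue. t \<in> {0..} \<longrightarrow> (x has_vector_derivative k t) (at t)"
        using AE by (rule eventually_mono) (use k(1) in simp)
      then show ?thesis by (simp add: AE_restrict_space_iff)
    qed
    show "(k has_integral x T - x 0) {0..T}" if "0 \<le> T" for T
    proof (rule abs_cont_imp_has_integral)
      show "abs_cont_on {0..T} x" using assms unfolding W1_inf_def by auto
      show "negligible N" using N(2) by (simp add: negligible_iff_null_sets)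
      show "(x has_vector_derivative k t) (at t)" if "t \<in> {0..T} - N" for t
        using that N(1) by (intro k) auto
    qed fact
  qed
qed

lemma W1_inf_diff_derivative:
  assumes "x \<in> W1_inf" "y \<in> W1_inf"
  obtains k M where "\<And>t. norm (k t) \<le> M"
    "AE t in lebesgue_on {0..}. ((\<lambda>t. x t - y t) has_vector_derivative k t) (at t)"
    "\<And>T. 0 \<le> T \<Longrightarrow> (k has_integral (x T - y T) - (x 0 - y 0)) {0..T}"
proof -
  obtain k1 M1 where 1: "\<And>t. norm (k1 t) \<le> M1"
    "AE t in lebesgue_on {0..}. (x has_vector_derivative k1 t) (at t)"
    "\<And>T. 0 \<le> T \<Longrightarrow> (k1 has_integral x T - x 0) {0..T}"
    by (rule W1_inf_derivative[OF assms(1)]) (rule that)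
  obtain k2 M2 where 2: "\<And>t. norm (k2 t) \<le> M2"
    "AE t in lebesgue_on {0..}. (y has_vector_derivative k2 t) (at t)"
    "\<And>T. 0 \<le> T \<Longrightarrow> (k2 has_integral y T - y 0) {0..T}"
    by (rule W1_inf_derivative[OF assms(2)]) (rule that)
  show thesis
  proof
    show "norm (k1 t - k2 t) \<le> M1 + M2" for t
      using norm_triangle_ineq4[of "k1 t" "k2 t"] 1(1)[of t] 2(1)[of t] by linarith
    show "AE t in lebesgue_on {0..}. ((\<lambda>t. x t - y t) has_vector_derivative k1 t - k2 t) (at t)"
      using 1(2) 2(2) by eventually_elim (rule has_vector_derivative_diff)
    show "((\<lambda>t. k1 t - k2 t) has_integral (x T - y T) - (x 0 - y 0)) {0..T}" if "0 \<le> T" for T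
    proof -
      have "(x T - x 0) - (y T - y 0) = (x T - y T) - (x 0 - y 0)" by simp
      then show ?thesis using has_integral_diff[OF 1(3)[OF that] 2(3)[OF that]] by (simp only:)
    qed
  qed
qed

text \<open>The primitive is first known for the gauge integral. A bounded measurable function on a
  compact interval is absolutely integrable, so the Lebesgue integral exists and uniqueness
  identifies the two values.\<close>

lemma bounded_primitive_measurable_integral:
  fixes k :: "real \<Rightarrow> 'a::euclidean_space"
  assumes b: "\<And>t. norm (k t) \<le> M" and h: "\<And>t. 0 \<le> t \<Longrightarrow> (k has_integral h t - h 0) {0..t}"
  shows "k \<in> borel_measurable (lebesgue_on {0..T})"
    and "0 \<le> t \<Longrightarrow> (LINT r:{0..t}|lebesgue. k r) = h t - h 0"
proof -
  have m: "k \<in> borel_measurable (lebesgue_on {0..T})" for T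
  proof (rule integrable_imp_measurable)
    show "k integrable_on {0..T}"
      using has_integral_integrable[OF h[of T]] by (cases "0 \<le> T") (simp_all add: integrable_on_empty)
  qed
  then show "k \<in> borel_measurable (lebesgue_on {0..T})" .
  show "(LINT r:{0..t}|lebesgue. k r) = h t - h 0" if "0 \<le> t"
  proof -
    have "k absolutely_integrable_on {0..t}"
      by (rule measurable_bounded_by_integrable_imp_absolutely_integrable[OF m, where g = "\<lambda>_. M"])
        (use b in auto)
    then have "(k has_integral (LINT r:{0..t}|lebesgue. k r)) {0..t}"
      by (rule has_integral_set_lebesgue)
    then show ?thesis using h[OF that] has_integral_unique by blast
  qed
qed

section \<open>Gradients and concavity\<close>

text \<open>The point \<open>c\<close> lies between \<open>y\<close> and a point slightly beyond
  \<open>c\<close> on the opposite side. There \<open>F\<close> is bounded below by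
  \<open>G\<close>, while \<open>F\<close> equals \<open>G\<close> at \<open>c\<close>, so concavity
  bounds a difference quotient of \<open>G\<close> by \<open>G c - F y\<close>; letting the step
  tend to \<open>0\<close> yields the derivative.\<close>

lemma ereal_concave_on_le_derivative:
  fixes F :: "'a::real_normed_vector \<Rightarrow> ereal" and G :: "'a \<Rightarrow> real"
  assumes conc: "ereal_concave_on {x. norm (x - c) \<le> \<gamma>} F"
    and minor: "\<And>x. norm (x - c) \<le> \<gamma> \<Longrightarrow> ereal (G x) \<le> F x"
    and touch: "F c = ereal (G c)"
    and deriv: "(G has_derivative L) (at c)"
    and y: "norm (y - c) \<le> \<gamma>"
  shows "F y \<le> ereal (G c + L (y - c))"
proof -
  define d where "d = y - c"
  have \<gamma>: "0 \<le> \<gamma>" using y norm_ge_zero order_trans by blast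
  \<comment> \<open>These are the weights with which \<open>c - s *\<^sub>R d\<close> and
    \<open>y = c + d\<close> average to \<open>c\<close>.\<close>
  have *: "ereal (1 / (1 + s)) * ereal (G (c - s *\<^sub>R d)) + ereal (s / (1 + s)) * F y \<le> ereal (G c)"
    if s: "0 < s" "s \<le> 1" for s
  proof -
    have n: "norm (c - s *\<^sub>R d - c) \<le> \<gamma>"
    proof -
      have "norm (c - s *\<^sub>R d - c) = s * norm d" using s by simp
      also have "\<dots> \<le> 1 * norm d" using s by (intro mult_right_mono) auto
      finally show ?thesis using y d_def by simp
    qed
    have comb: "(1 / (1 + s)) *\<^sub>R (c - s *\<^sub>R d) + (s / (1 + s)) *\<^sub>R y = c"
    proof -
      have "y = c + d" by (simp add: d_def)
      then have "(1 / (1 + s)) *\<^sub>R (c - s *\<^sub>R d) + (s / (1 + s)) *\<^sub>R y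
          = (1 / (1 + s) + s / (1 + s)) *\<^sub>R c + (s / (1 + s) - s / (1 + s)) *\<^sub>R d"
        by (simp add: scaleR_add_right scaleR_diff_right scaleR_add_left)
      also have "1 / (1 + s) + s / (1 + s) = 1"
        using s by (simp add: add_divide_distrib[symmetric])
      finally show ?thesis by simp
    qed
    have "ereal (1 / (1 + s)) * ereal (G (c - s *\<^sub>R d)) + ereal (s / (1 + s)) * F y
        \<le> ereal (1 / (1 + s)) * F (c - s *\<^sub>R d) + ereal (s / (1 + s)) * F y"
      using s by (intro add_right_mono ereal_mult_left_mono minor n) auto
    also have "\<dots> \<le> F ((1 / (1 + s)) *\<^sub>R (c - s *\<^sub>R d) + (s / (1 + s)) *\<^sub>R y)"
    proof -
      have "1 / (1 + s) + s / (1 + s) = 1" "0 \<le> 1 / (1 + s)" "0 \<le> s / (1 + s)"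
        using s by (simp_all add: add_divide_distrib[symmetric])
      then show ?thesis
        using conc n y unfolding ereal_concave_on_def by blast
    qed
    finally show ?thesis by (simp add: comb touch)
  qed
  \<comment> \<open>The value \<open>\<infinity>\<close> at \<open>y\<close> would make the left
    side of \<open>*\<close> infinite already for \<open>s = 1\<close>, against the finite
    \<open>G c\<close>; the value \<open>-\<infinity>\<close> is excluded by
    \<open>minor\<close>.\<close>
  obtain r where r: "F y = ereal r"
  proof (cases "F y")
    case PInf
    then show ?thesis using *[of 1] by simp
  next
    case MInf
    then show ?thesis using minor[OF y] by simp
  qed
  have **: "(G (c - s *\<^sub>R d) - G c) / s \<le> G c - r" if s: "0 < s" "s \<le> 1" for s
  proof -
    have "1 / (1 + s) * G (c - s *\<^sub>R d) + s / (1 + s) * r \<le> G c"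
      using *[OF s] r by simp
    then have "(G (c - s *\<^sub>R d) + s * r) / (1 + s) \<le> G c"
      by (simp add: add_divide_distrib)
    then have "G (c - s *\<^sub>R d) + s * r \<le> G c * (1 + s)"
      using s by (simp add: pos_divide_le_eq)
    then have "G (c - s *\<^sub>R d) - G c \<le> (G c - r) * s"
      by (simp add: algebra_simps)
    then show ?thesis using s by (simp only: pos_divide_le_eq)
  qed
  have lin: "bounded_linear L" using deriv by (rule has_derivative_bounded_linear)
  have "((\<lambda>s. c - s *\<^sub>R d) has_derivative (\<lambda>s. - (s *\<^sub>R d))) (at 0)"
    by (auto intro!: derivative_eq_intros)
  then have "((\<lambda>s. G (c - s *\<^sub>R d)) has_derivative (\<lambda>s. L (- (s *\<^sub>R d)))) (at 0)"
    using has_derivative_compose[of "\<lambda>s. c - s *\<^sub>R d" _ 0 UNIV G L] deriv by simp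
  moreover have "(\<lambda>s. L (- (s *\<^sub>R d))) = (*) (- L d)"
    using lin by (auto simp: fun_eq_iff linear_neg linear_scale bounded_linear.linear)
  ultimately have "((\<lambda>s. G (c - s *\<^sub>R d)) has_field_derivative - L d) (at 0)"
    unfolding has_field_derivative_def by simp
  then have "((\<lambda>s. (G (c - s *\<^sub>R d) - G c) / s) \<longlongrightarrow> - L d) (at_right 0)"
    unfolding DERIV_def by (auto intro: filterlim_mono at_le)
  moreover have "\<forall>\<^sub>F s in at_right 0. (G (c - s *\<^sub>R d) - G c) / s \<le> G c - r"
    unfolding eventually_at_right_field using ** by (intro exI[of _ 1]) auto
  ultimately have "- L d \<le> G c - r"
    by (rule tendsto_upperbound) simp
  then show ?thesis by (simp add: r d_def)
qed

text \<open>By the Riesz representation \<open>adjoint L 1\<close> is a gradient, and uniqueness of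
  derivatives makes it the only one, so the definite description in \<open>gradient\<close> denotes
  it.\<close>

lemma GDERIV_gradient:
  fixes F :: "'a::euclidean_space \<Rightarrow> real"
  assumes "(F has_derivative L) (at x)"
  shows "GDERIV F x :> gradient F x"
proof -
  have "linear L" using assms has_derivative_linear by blast
  then have "L = (\<lambda>v. v \<bullet> adjoint L 1)"
    by (auto simp: adjoint_works fun_eq_iff)
  then have D: "GDERIV F x :> adjoint L 1"
    using assms unfolding gderiv_def by simp
  have uniq: "E = adjoint L 1" if "GDERIV F x :> E" for E
  proof -
    have "(\<lambda>h. h \<bullet> E) = (\<lambda>h. h \<bullet> adjoint L 1)"
      using that D unfolding gderiv_def by (rule has_derivative_unique)
    then show ?thesis by (metis vector_eq_ldot)
  qed
  show ?thesis
    unfolding gradient_def by (rule theI[where P = "gderiv F x", OF D uniq])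
qed

lemma inner_gradient:
  fixes F :: "'a::euclidean_space \<Rightarrow> real"
  assumes "(F has_derivative L) (at x)"
  shows "gradient F x \<bullet> v = L v"
  using GDERIV_gradient[OF assms] assms has_derivative_unique
  unfolding gderiv_def by (metis inner_commute)

text \<open>For boundedness, \<open>arctan\<close> embeds the half-line in a bounded interval. Along
  the bounded \<open>x\<close>, the map \<open>h\<close> thus becomes uniformly continuous on a
  bounded set in a space with the Heine-Borel property, and its image is bounded.\<close>

lemma ext_uniformly_continuous_on_along:
  fixes h :: "real \<Rightarrow> 'a::heine_borel \<Rightarrow> 'b::metric_space \<Rightarrow> 'c::heine_borel"
  assumes uc: "ext_uniformly_continuous_on S h"
    and S: "\<And>t. 0 \<le> t \<Longrightarrow> (t, x t, u) \<in> S"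
    and x: "continuous_on {0..} x" "bounded (x ` {0..})"
  shows "continuous_on {0..} (\<lambda>t. h t (x t) u)" "bounded ((\<lambda>t. h t (x t) u) ` {0..})"
proof -
  have uc': "\<exists>\<delta>>0. \<forall>t\<ge>0. \<forall>s\<ge>0. \<bar>arctan t - arctan s\<bar> < \<delta> \<and> dist (x t) (x s) < \<delta>
      \<longrightarrow> dist (h t (x t) u) (h s (x s) u) < \<epsilon>" if e: "\<epsilon> > 0" for \<epsilon>
  proof -
    obtain \<delta> where \<delta>: "\<delta> > 0" and *: "\<forall>(t,x,u)\<in>S. \<forall>(s,y,v)\<in>S.
        \<bar>arctan t - arctan s\<bar> < \<delta> \<and> dist x y < \<delta> \<and> dist u v < \<delta>
        \<longrightarrow> dist (h t x u) (h s y v) < \<epsilon>"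
      using uc e unfolding ext_uniformly_continuous_on_def by meson
    have "dist (h t (x t) u) (h s (x s) u) < \<epsilon>"
      if "t \<ge> 0" "s \<ge> 0" "\<bar>arctan t - arctan s\<bar> < \<delta>" "dist (x t) (x s) < \<delta>" for t s
      using bspec[OF bspec[OF *[unfolded split_def] S[OF that(1)]] S[OF that(2)]] that \<delta> by simp
    then show ?thesis using \<delta> by blast
  qed
  show "continuous_on {0..} (\<lambda>t. h t (x t) u)"
    unfolding continuous_on_def
  proof (intro ballI tendstoI)
    fix t :: real and \<epsilon> :: real assume t: "t \<in> {0..}" and e: "\<epsilon> > 0"
    obtain \<delta> where \<delta>: "\<delta> > 0" and *: "\<And>t s. t\<ge>0 \<Longrightarrow> s\<ge>0 \<Longrightarrow> \<bar>arctan t - arctan s\<bar> < \<delta> \<Longrightarrow>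
        dist (x t) (x s) < \<delta> \<Longrightarrow> dist (h t (x t) u) (h s (x s) u) < \<epsilon>"
      using uc'[OF e] by blast
    have "(arctan \<longlongrightarrow> arctan t) (at t within {0..})"
      by (intro tendsto_arctan tendsto_ident_at)
    then have "\<forall>\<^sub>F s in at t within {0..}. dist (arctan s) (arctan t) < \<delta>"
      using \<delta> by (rule tendstoD)
    moreover have "\<forall>\<^sub>F s in at t within {0..}. dist (x s) (x t) < \<delta>"
      using x(1) t \<delta> unfolding continuous_on_def by (blast intro: tendstoD)
    moreover have "\<forall>\<^sub>F s in at t within {0..}. s \<in> {0..}"
      by (simp add: eventually_at_filter)
    ultimately show "\<forall>\<^sub>F s in at t within {0..}. dist (h s (x s) u) (h t (x t) u) < \<epsilon>"
      by eventually_elim (use t in \<open>auto simp: dist_real_def intro: *\<close>)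
  qed
  \<comment> \<open>Time is recovered from its compactified coordinate because \<open>tan\<close>
    inverts \<open>arctan\<close>.\<close>
  let ?A = "(\<lambda>t. (arctan t, x t)) ` {0..}"
  let ?h = "\<lambda>(a, y). h (tan a) y u"
  have "uniformly_continuous_on ?A ?h"
    unfolding uniformly_continuous_on_def
  proof (intro allI impI)
    fix \<epsilon> :: real assume e: "\<epsilon> > 0"
    obtain \<delta> where \<delta>: "\<delta> > 0" and *: "\<And>t s. t\<ge>0 \<Longrightarrow> s\<ge>0 \<Longrightarrow> \<bar>arctan t - arctan s\<bar> < \<delta> \<Longrightarrow>
        dist (x t) (x s) < \<delta> \<Longrightarrow> dist (h t (x t) u) (h s (x s) u) < \<epsilon>"
      using uc'[OF e] by blast
    have "dist (?h (arctan s, x s)) (?h (arctan t, x t)) < \<epsilon>"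
      if "t \<ge> 0" "s \<ge> 0" "dist (arctan s, x s) (arctan t, x t) < \<delta>" for t s
    proof -
      have "dist (arctan s) (arctan t) < \<delta>" "dist (x s) (x t) < \<delta>"
        using that(3) dist_fst_le[of "(arctan s, x s)" "(arctan t, x t)"]
          dist_snd_le[of "(arctan s, x s)" "(arctan t, x t)"] by auto
      then show ?thesis using that *[of s t] by (simp add: tan_arctan dist_real_def)
    qed
    then show "\<exists>d>0. \<forall>z\<in>?A. \<forall>z'\<in>?A. dist z' z < d \<longrightarrow> dist (?h z') (?h z) < \<epsilon>"
      using \<delta> by blast
  qed
  moreover have "bounded ?A"
  proof -
    have "?A \<subseteq> {- (pi/2)..pi/2} \<times> x ` {0..}"
      using less_imp_le[OF arctan_lbound] less_imp_le[OF arctan_ubound] by fastforce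
    then show ?thesis
      by (rule bounded_subset[OF bounded_Times[OF bounded_closed_interval x(2)]])
  qed
  ultimately have "bounded (?h ` ?A)"
    by (rule bounded_uniformly_continuous_image)
  then show "bounded ((\<lambda>t. h t (x t) u) ` {0..})"
    by (simp add: image_image tan_arctan)
qed

section \<open>Integration by parts\<close>

text \<open>Fubini's theorem is applied below with Lebesgue measure on the half-line as a factor.
  The exhausting sets of \<open>lborel\<close> keep their measure under completion.\<close>

lemma sigma_finite_lebesgue: "sigma_finite_measure (lebesgue :: 'a::euclidean_space measure)"
proof
  obtain A :: "'a set set" where A: "countable A" "A \<subseteq> sets lborel" "\<Union>A = space lborel" "\<forall>a\<in>A. emeasure lborel a \<noteq> \<infinity>"
    using lborel.sigma_finite_countable by metis
  show "\<exists>A::'a set set. countable A \<and> A \<subseteq> sets lebesgue \<and> \<Union>A = space lebesgue \<and> (\<forall>a\<in>A. emeasure lebesgue a \<noteq> \<infinity>)"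
    using A by (intro exI[of _ A]) (auto simp: emeasure_completion)
qed

text \<open>Integration by parts for a primitive \<open>h\<close> of \<open>k\<close> and the function
  \<open>t \<mapsto> \<integral>\<^bsub>{t \<le> \<sigma>}\<^esub> G dM\<close>, which need not be continuous.\<close>

lemma
  fixes G :: "'b \<Rightarrow> 'a::euclidean_space" and k :: "real \<Rightarrow> 'a"
  assumes M: "sigma_finite_measure M" and G: "integrable M G"
    and \<sigma>: "\<sigma> \<in> borel_measurable M" "\<And>s. s \<in> space M \<Longrightarrow> 0 \<le> \<sigma> s \<and> \<sigma> s \<le> T"
    and k: "k \<in> borel_measurable (lebesgue_on {0..T})" "\<And>t. norm (k t) \<le> C"
    and h: "\<And>t. 0 \<le> t \<Longrightarrow> t \<le> T \<Longrightarrow> (LINT r:{0..t}|lebesgue. k r) = h t - h 0"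
  shows integrable_tail_inner:
      "integrable (lebesgue_on {0..T}) (\<lambda>t. (LINT s|M. indicator {..\<sigma> s} t *\<^sub>R G s) \<bullet> k t)"
    and integral_tail_inner:
      "(LINT t|lebesgue_on {0..T}. (LINT s|M. indicator {..\<sigma> s} t *\<^sub>R G s) \<bullet> k t)
        = (LINT s|M. G s \<bullet> h (\<sigma> s)) - (LINT s|M. G s) \<bullet> h 0"
    and integrable_inner_primitive: "integrable M (\<lambda>s. G s \<bullet> h (\<sigma> s))"
proof -
  interpret M: sigma_finite_measure M by fact
  interpret L: finite_measure "lebesgue_on {0..T}"
    by (rule finite_measure_lebesgue_on) auto
  interpret P: pair_sigma_finite "lebesgue_on {0..T}" M ..
  let ?L = "lebesgue_on {0..T}"
  \<comment> \<open>\<open>F\<close> is the common integrand: integrating over \<open>s\<close>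
    gives the tail integral paired with \<open>k t\<close>, integrating over \<open>t\<close> gives
    an increment of \<open>h\<close> paired with \<open>G s\<close>.\<close>
  define F where "F t s = indicator {..\<sigma> s} t * (G s \<bullet> k t)" for t s
  have C: "0 \<le> C" using k(2)[of 0] norm_ge_zero order_trans by blast
  have Gm: "G \<in> borel_measurable M" using G by auto
  have m1[measurable]: "fst \<in> borel_measurable (?L \<Otimes>\<^sub>M M)"
  proof -
    have "(\<lambda>t. t) \<in> borel_measurable ?L"
      by (rule measurable_restrict_space1) (auto intro: measurable_completion)
    then show ?thesis by (rule measurable_compose[OF measurable_fst])
  qed
  have m2[measurable]: "(\<lambda>z. k (fst z)) \<in> borel_measurable (?L \<Otimes>\<^sub>M M)"
    by (rule measurable_compose[OF measurable_fst k(1)])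
  have m3[measurable]: "(\<lambda>z. G (snd z)) \<in> borel_measurable (?L \<Otimes>\<^sub>M M)"
    by (rule measurable_compose[OF measurable_snd Gm])
  have m4[measurable]: "(\<lambda>z. \<sigma> (snd z)) \<in> borel_measurable (?L \<Otimes>\<^sub>M M)"
    by (rule measurable_compose[OF measurable_snd \<sigma>(1)])
  have "(\<lambda>z. (if fst z \<le> \<sigma> (snd z) then 1 else 0) * (G (snd z) \<bullet> k (fst z))) \<in> borel_measurable (?L \<Otimes>\<^sub>M M)"
    by measurable
  then have Fm: "case_prod F \<in> borel_measurable (?L \<Otimes>\<^sub>M M)"
    by (rule measurable_cong[THEN iffD1, rotated]) (auto simp: F_def)
  \<comment> \<open>This bound is integrable in \<open>s\<close> and uniform in \<open>t\<close>; as
    \<open>{0..T}\<close> has finite measure, \<open>F\<close> becomes integrable on the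
    product.\<close>
  have Fb: "norm (F t s) \<le> C * norm (G s)" for t s
  proof -
    have "norm (F t s) \<le> norm (G s \<bullet> k t)" by (auto simp: F_def indicator_def)
    also have "\<dots> \<le> norm (G s) * norm (k t)" using Cauchy_Schwarz_ineq2[of "G s" "k t"] by simp
    also have "\<dots> \<le> norm (G s) * C" by (intro mult_left_mono k(2)) auto
    finally show ?thesis by (simp add: mult.commute)
  qed
  have CG: "integrable M (\<lambda>s. C * norm (G s))" using G by simp
  have int2: "integrable M (F t)" if "t \<in> space ?L" for t
  proof (rule Bochner_Integration.integrable_bound[OF CG])
    show "F t \<in> borel_measurable M"
      using measurable_compose[OF measurable_Pair1'[OF that] Fm] by simp
    show "AE s in M. norm (F t s) \<le> norm (C * norm (G s))"
      using Fb C by simp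
  qed
  have int1: "integrable ?L (\<lambda>t. \<integral>s. norm (F t s) \<partial>M)"
  proof (rule L.integrable_const_bound[where B = "\<integral>s. C * norm (G s) \<partial>M"])
    have "case_prod (\<lambda>t s. norm (F t s)) \<in> borel_measurable (?L \<Otimes>\<^sub>M M)"
      using Fm by (simp add: case_prod_unfold)
    then show "(\<lambda>t. \<integral>s. norm (F t s) \<partial>M) \<in> borel_measurable ?L"
      by (rule M.borel_measurable_lebesgue_integral)
    show "AE t in ?L. norm (\<integral>s. norm (F t s) \<partial>M) \<le> (\<integral>s. C * norm (G s) \<partial>M)"
    proof (rule AE_I2)
      fix t assume "t \<in> space ?L"
      then have "(\<integral>s. norm (F t s) \<partial>M) \<le> (\<integral>s. C * norm (G s) \<partial>M)"
        using CG Fb int2 by (intro integral_mono integrable_norm) auto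
      moreover have "0 \<le> (\<integral>s. norm (F t s) \<partial>M)" by (rule integral_nonneg_AE) auto
      ultimately show "norm (\<integral>s. norm (F t s) \<partial>M) \<le> (\<integral>s. C * norm (G s) \<partial>M)" by simp
    qed
  qed
  have int: "integrable (?L \<Otimes>\<^sub>M M) (case_prod F)"
    using int1 int2 by (intro P.Fubini_integrable Fm AE_I2) auto
  have in2: "(\<integral>s. F t s \<partial>M) = (LINT s|M. indicator {..\<sigma> s} t *\<^sub>R G s) \<bullet> k t"
    if "t \<in> space ?L" for t
  proof -
    have "integrable M (\<lambda>s. indicator {..\<sigma> s} t *\<^sub>R G s)"
    proof (rule Bochner_Integration.integrable_bound[OF G])
      have "(\<lambda>s. (if t \<le> \<sigma> s then 1 else 0) *\<^sub>R G s) \<in> borel_measurable M"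
        using Gm \<sigma>(1) by measurable
      then show "(\<lambda>s. indicator {..\<sigma> s} t *\<^sub>R G s) \<in> borel_measurable M"
        by (rule measurable_cong[THEN iffD1, rotated]) auto
    qed (auto simp: indicator_def)
    then have "(LINT s|M. indicator {..\<sigma> s} t *\<^sub>R G s) \<bullet> k t = (LINT s|M. (indicator {..\<sigma> s} t *\<^sub>R G s) \<bullet> k t)"
      by (intro integral_inner_left[symmetric])
    then show ?thesis by (simp add: F_def)
  qed
  have in1: "(\<integral>t. F t s \<partial>?L) = G s \<bullet> (h (\<sigma> s) - h 0)" if s: "s \<in> space M" for s
  proof -
    have "integrable ?L k"
      using k by (intro L.integrable_const_bound[where B = C]) auto
    then have kL: "integrable lebesgue (\<lambda>t. indicator {0..T} t *\<^sub>R k t)"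
      by (subst (asm) integrable_restrict_space) auto
    have "integrable lebesgue (\<lambda>t. indicator {0..\<sigma> s} t *\<^sub>R indicator {0..T} t *\<^sub>R k t)"
      using kL by (rule integrable_mult_indicator[rotated]) auto
    then have ki: "integrable lebesgue (\<lambda>t. indicator {0..\<sigma> s} t *\<^sub>R k t)"
      by (rule Bochner_Integration.integrable_cong[THEN iffD1, rotated 2])
        (use \<sigma>(2)[OF s] in \<open>auto simp: indicator_def\<close>)
    have "(\<integral>t. F t s \<partial>?L) = (\<integral>t. indicator {0..T} t *\<^sub>R F t s \<partial>lebesgue)"
      by (rule integral_restrict_space) auto
    also have "\<dots> = (\<integral>t. G s \<bullet> (indicator {0..\<sigma> s} t *\<^sub>R k t) \<partial>lebesgue)"
      by (rule Bochner_Integration.integral_cong) (use \<sigma>(2)[OF s] in \<open>auto simp: F_def indicator_def\<close>)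
    also have "\<dots> = G s \<bullet> (LINT r:{0..\<sigma> s}|lebesgue. k r)"
      unfolding set_lebesgue_integral_def using ki by (intro integral_inner_right)
    finally show ?thesis using h \<sigma>(2)[OF s] by simp
  qed
  have "integrable ?L (\<lambda>t. \<integral>s. F t s \<partial>M)"
    using P.integrable_fst'[OF int] by simp
  then show "integrable ?L (\<lambda>t. (LINT s|M. indicator {..\<sigma> s} t *\<^sub>R G s) \<bullet> k t)"
    by (rule Bochner_Integration.integrable_cong[THEN iffD1, rotated 2]) (use in2 in auto)
  have "integrable M (\<lambda>s. \<integral>t. F t s \<partial>?L)"
    using P.integrable_snd[OF int] by simp
  then have int_diff: "integrable M (\<lambda>s. G s \<bullet> (h (\<sigma> s) - h 0))"
    by (rule Bochner_Integration.integrable_cong[THEN iffD1, rotated 2]) (use in1 in auto)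
  have int0: "integrable M (\<lambda>s. G s \<bullet> h 0)" using G by (rule integrable_inner_left)
  show int_h: "integrable M (\<lambda>s. G s \<bullet> h (\<sigma> s))"
    using Bochner_Integration.integrable_add[OF int_diff int0] by (simp add: inner_diff_right)
  have "(\<integral>t. (\<integral>s. F t s \<partial>M) \<partial>?L) = (\<integral>s. (\<integral>t. F t s \<partial>?L) \<partial>M)"
    using P.Fubini_integral[OF int] by simp
  moreover have "(\<integral>t. (\<integral>s. F t s \<partial>M) \<partial>?L) = (LINT t|?L. (LINT s|M. indicator {..\<sigma> s} t *\<^sub>R G s) \<bullet> k t)"
    by (rule Bochner_Integration.integral_cong) (use in2 in auto)
  moreover have "(\<integral>s. (\<integral>t. F t s \<partial>?L) \<partial>M) = (LINT s|M. G s \<bullet> (h (\<sigma> s) - h 0))"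
    by (rule Bochner_Integration.integral_cong) (use in1 in auto)
  moreover have "(LINT s|M. G s \<bullet> (h (\<sigma> s) - h 0)) = (LINT s|M. G s \<bullet> h (\<sigma> s)) - (LINT s|M. G s) \<bullet> h 0"
    using int_h int0 G by (simp add: inner_diff_right)
  ultimately show "(LINT t|?L. (LINT s|M. indicator {..\<sigma> s} t *\<^sub>R G s) \<bullet> k t)
        = (LINT s|M. G s \<bullet> h (\<sigma> s)) - (LINT s|M. G s) \<bullet> h 0" by simp
qed

text \<open>Since \<open>enn2real\<close> sends \<open>\<infinity>\<close> to \<open>0\<close>,
  extended times are capped at \<open>T\<close> before conversion. For \<open>t\<close> in
  \<open>{0..T}\<close> the cap does not affect whether \<open>s\<close> lies in the tail starting
  at \<open>t\<close>.\<close>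

lemma le_enn2real_min_iff:
  assumes "0 \<le> t" "t \<le> T"
  shows "t \<le> enn2real (min s (ennreal T)) \<longleftrightarrow> ennreal t \<le> s"
proof (cases s)
  case (real r)
  then show ?thesis using assms by (cases "r \<le> T") (auto simp: min_absorb1 min_absorb2)
next
  case top
  then show ?thesis using assms by simp
qed

lemma enn2real_min_bounds:
  assumes "0 \<le> T"
  shows "0 \<le> enn2real (min s (ennreal T))" "enn2real (min s (ennreal T)) \<le> T"
  using assms by (auto intro: enn2real_leI)

text \<open>The representation writes \<open>p\<close> as a constant plus a tail integral of
  \<open>\<eta>\<close> minus tail integrals for the \<open>\<mu> j\<close>, and each tail is
  integrated by parts with time capped at \<open>T\<close>. The contributions at time
  \<open>0\<close> assemble into \<open>p 0 \<bullet> h 0\<close> through the representation at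
  \<open>t = 0\<close>; everything beyond \<open>T\<close> is paired with
  \<open>h T\<close>.\<close>

lemma
  fixes p h k \<eta> :: "real \<Rightarrow> 'a::euclidean_space" and \<mu> :: "nat \<Rightarrow> ennreal measure"
    and \<Gamma> :: "nat \<Rightarrow> ennreal \<Rightarrow> 'a"
  assumes k: "k \<in> borel_measurable (lebesgue_on {0..T})" "\<And>t. norm (k t) \<le> C"
      "\<And>t. 0 \<le> t \<Longrightarrow> t \<le> T \<Longrightarrow> (LINT r:{0..t}|lebesgue. k r) = h t - h 0"
    and T: "0 \<le> T"
    and \<eta>: "set_integrable lebesgue {0..} \<eta>"
    and \<mu>: "\<And>j. j \<in> {1..l} \<Longrightarrow> finite_measure (\<mu> j)" "\<And>j. j \<in> {1..l} \<Longrightarrow> sets (\<mu> j) = sets borel"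
    and \<Gamma>: "\<And>j. j \<in> {1..l} \<Longrightarrow> integrable (\<mu> j) (\<Gamma> j)"
    and p: "\<And>t. 0 \<le> t \<Longrightarrow> p t = q + (LINT s:{t..}|lebesgue. \<eta> s)
        - (\<Sum>j=1..l. LINT s:{ennreal t..}|\<mu> j. \<Gamma> j s)"
  shows integrable_adjoint_inner: "integrable (lebesgue_on {0..T}) (\<lambda>t. p t \<bullet> k t - \<eta> t \<bullet> h t)"
    and integral_adjoint_inner:
      "(LINT t|lebesgue_on {0..T}. p t \<bullet> k t - \<eta> t \<bullet> h t)
        = q \<bullet> h T - p 0 \<bullet> h 0
          + ((LINT s:{0..}|lebesgue. \<eta> s) - (LINT s:{0..T}|lebesgue. \<eta> s)) \<bullet> h T
          - (\<Sum>j=1..l. LINT s|\<mu> j. \<Gamma> j s \<bullet> h (enn2real (min s (ennreal T))))"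
    and integrable_multiplier_inner:
      "\<And>j. j \<in> {1..l} \<Longrightarrow> integrable (\<mu> j) (\<lambda>s. \<Gamma> j s \<bullet> h (enn2real (min s (ennreal T))))"
proof -
  let ?L = "lebesgue_on {0..T}" and ?M = "lebesgue_on {0::real..}"
  let ?\<sigma> = "\<lambda>s. enn2real (min s (ennreal T))"
  interpret L: finite_measure ?L
    by (rule finite_measure_lebesgue_on) auto
  have M: "sigma_finite_measure ?M"
    by (rule sigma_finite_measure_restrict_space[OF sigma_finite_lebesgue]) auto
  have \<eta>M: "integrable ?M \<eta>"
    using \<eta> unfolding set_integrable_def by (subst integrable_restrict_space) auto
  have m: "(\<lambda>s. min s T) \<in> borel_measurable ?M"
    by (intro measurable_restrict_space1 measurable_completion) simp
  have b: "0 \<le> min s T \<and> min s T \<le> T" if "s \<in> space ?M" for s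
    using that T by (auto simp: space_restrict_space)
  note parts\<eta> = integrable_tail_inner[OF M \<eta>M m b k] integral_tail_inner[OF M \<eta>M m b k]
    integrable_inner_primitive[OF M \<eta>M m b k]
  have m\<mu>: "?\<sigma> \<in> borel_measurable (\<mu> j)" if "j \<in> {1..l}" for j
    by (subst measurable_cong_sets[OF \<mu>(2)[OF that] refl]) measurable
  have b\<mu>: "0 \<le> ?\<sigma> s \<and> ?\<sigma> s \<le> T" for s
    using enn2real_min_bounds[OF T] by blast
  have sf: "sigma_finite_measure (\<mu> j)" if "j \<in> {1..l}" for j
    using \<mu>(1)[OF that] by (simp add: finite_measure_def)
  note parts\<mu> = integrable_tail_inner[OF sf \<Gamma> m\<mu> b\<mu> k] integral_tail_inner[OF sf \<Gamma> m\<mu> b\<mu> k]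
    integrable_inner_primitive[OF sf \<Gamma> m\<mu> b\<mu> k]
  show "integrable (\<mu> j) (\<lambda>s. \<Gamma> j s \<bullet> h (?\<sigma> s))" if "j \<in> {1..l}" for j
    using parts\<mu>(3)[OF that that that] .

  \<comment> \<open>For \<open>t\<close> in \<open>{0..T}\<close> capping inside the indicator
    changes nothing, so \<open>P\<close> and \<open>Q\<close> are there the two kinds of tail in
    \<open>p\<close>, in the form required for integration by parts.\<close>
  define P where "P t = (LINT s|?M. indicator {..min s T} t *\<^sub>R \<eta> s)" for t
  define Q where "Q j t = (LINT s|\<mu> j. indicator {..?\<sigma> s} t *\<^sub>R \<Gamma> j s)" for j t
  have P: "P t = (LINT s:{t..}|lebesgue. \<eta> s)" if t: "t \<in> {0..T}" for t
  proof -
    have "P t = (LINT s|lebesgue. indicator {0..} s *\<^sub>R indicator {..min s T} t *\<^sub>R \<eta> s)"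
      unfolding P_def by (rule integral_restrict_space) auto
    also have "\<dots> = (LINT s:{t..}|lebesgue. \<eta> s)"
      unfolding set_lebesgue_integral_def
      by (rule Bochner_Integration.integral_cong) (use t in \<open>auto simp: indicator_def\<close>)
    finally show ?thesis .
  qed
  have Q: "Q j t = (LINT s:{ennreal t..}|\<mu> j. \<Gamma> j s)" if t: "t \<in> {0..T}" for j t
    unfolding Q_def set_lebesgue_integral_def
    by (rule Bochner_Integration.integral_cong)
      (use t in \<open>auto simp: indicator_def le_enn2real_min_iff\<close>)
  have pPQ: "p t = q + P t - (\<Sum>j=1..l. Q j t)" if "t \<in> {0..T}" for t
    using p[of t] that by (simp add: P[OF that] Q[OF that])

  have kL: "integrable ?L k"
    using k by (intro L.integrable_const_bound[where B = C]) auto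
  have kint: "(LINT t|?L. k t) = h T - h 0"
    using k(3)[of T] T by (simp add: integral_restrict_space set_lebesgue_integral_def)
  have qk: "integrable ?L (\<lambda>t. q \<bullet> k t)" using kL by (rule integrable_inner_right)
  have Pk: "integrable ?L (\<lambda>t. P t \<bullet> k t)" using parts\<eta>(1) unfolding P_def .
  have Qk: "integrable ?L (\<lambda>t. Q j t \<bullet> k t)" if "j \<in> {1..l}" for j
    using parts\<mu>(1)[OF that that that] unfolding Q_def .
  have sumQk: "integrable ?L (\<lambda>t. \<Sum>j=1..l. Q j t \<bullet> k t)"
    by (rule Bochner_Integration.integrable_sum) (rule Qk)
  have pk: "p t \<bullet> k t = q \<bullet> k t + P t \<bullet> k t - (\<Sum>j=1..l. Q j t \<bullet> k t)" if "t \<in> space ?L" for t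
    using pPQ[of t] that by (simp add: inner_add_left inner_diff_left inner_sum_left)
  have ipk0: "integrable ?L (\<lambda>t. q \<bullet> k t + P t \<bullet> k t - (\<Sum>j=1..l. Q j t \<bullet> k t))"
    by (intro Bochner_Integration.integrable_diff Bochner_Integration.integrable_add qk Pk sumQk)
  then have ipk: "integrable ?L (\<lambda>t. p t \<bullet> k t)"
    by (rule Bochner_Integration.integrable_cong[THEN iffD1, rotated 2]) (use pk in auto)
  have "(LINT t|?L. p t \<bullet> k t) = (LINT t|?L. q \<bullet> k t + P t \<bullet> k t - (\<Sum>j=1..l. Q j t \<bullet> k t))"
    by (rule Bochner_Integration.integral_cong) (use pk in auto)
  also have "\<dots> = (LINT t|?L. q \<bullet> k t) + (LINT t|?L. P t \<bullet> k t) - (\<Sum>j=1..l. LINT t|?L. Q j t \<bullet> k t)"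
    by (subst Bochner_Integration.integral_diff Bochner_Integration.integral_add Bochner_Integration.integral_sum,
        (intro Bochner_Integration.integrable_add qk Pk sumQk Qk; assumption)+)+ simp
  also have "(LINT t|?L. q \<bullet> k t) = q \<bullet> (h T - h 0)"
    using kint kL by simp
  also have "(LINT t|?L. P t \<bullet> k t) = (LINT s|?M. \<eta> s \<bullet> h (min s T)) - (LINT s|?M. \<eta> s) \<bullet> h 0"
    unfolding P_def by (rule parts\<eta>(2))
  also have "(\<Sum>j=1..l. LINT t|?L. Q j t \<bullet> k t)
      = (\<Sum>j=1..l. (LINT s|\<mu> j. \<Gamma> j s \<bullet> h (?\<sigma> s)) - (LINT s|\<mu> j. \<Gamma> j s) \<bullet> h 0)"
    unfolding Q_def by (rule sum.cong[OF refl]) (rule parts\<mu>(2))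
  finally have I: "(LINT t|?L. p t \<bullet> k t) = q \<bullet> (h T - h 0)
      + ((LINT s|?M. \<eta> s \<bullet> h (min s T)) - (LINT s|?M. \<eta> s) \<bullet> h 0)
      - (\<Sum>j=1..l. (LINT s|\<mu> j. \<Gamma> j s \<bullet> h (?\<sigma> s)) - (LINT s|\<mu> j. \<Gamma> j s) \<bullet> h 0)" .
  have \<eta>0: "(LINT s|?M. \<eta> s) = (LINT s:{0..}|lebesgue. \<eta> s)"
    unfolding set_lebesgue_integral_def by (rule integral_restrict_space) auto
  \<comment> \<open>At \<open>t = 0\<close> the tail is all of \<open>[0, \<infinity>]\<close>,
    including a possible atom at \<open>\<infinity>\<close>.\<close>
  have "(LINT s:{ennreal 0..}|\<mu> j. \<Gamma> j s) = (LINT s|\<mu> j. \<Gamma> j s)" for j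
    unfolding set_lebesgue_integral_def by (rule Bochner_Integration.integral_cong) auto
  then have p0: "p 0 = q + (LINT s|?M. \<eta> s) - (\<Sum>j=1..l. LINT s|\<mu> j. \<Gamma> j s)"
    using p[of 0] \<eta>0 by simp

  have i0: "integrable ?M (\<lambda>s. indicator {0..T} s *\<^sub>R (\<eta> s \<bullet> h (min s T)))"
    by (rule integrable_mult_indicator[OF _ parts\<eta>(3)]) (auto simp: sets_restrict_space_iff)
  have i1: "integrable ?M (\<lambda>s. indicator {0..T} s *\<^sub>R \<eta> s)"
    by (rule integrable_mult_indicator[OF _ \<eta>M]) (auto simp: sets_restrict_space_iff)
  have \<eta>h: "integrable ?L (\<lambda>s. \<eta> s \<bullet> h s)"
  proof -
    have "integrable lebesgue (\<lambda>s. indicator {0..} s *\<^sub>R indicator {0..T} s *\<^sub>R (\<eta> s \<bullet> h (min s T)))"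
      using i0 by (subst (asm) integrable_restrict_space) auto
    then have "integrable lebesgue (\<lambda>s. indicator {0..T} s *\<^sub>R (\<eta> s \<bullet> h s))"
      by (rule Bochner_Integration.integrable_cong[THEN iffD1, rotated 2]) (auto simp: indicator_def min_def)
    then show ?thesis by (subst integrable_restrict_space) auto
  qed
  \<comment> \<open>Split at \<open>T\<close>: up to \<open>T\<close> the cap is inactive,
    afterwards \<open>h\<close> is frozen at \<open>h T\<close> and the remaining integral of
    \<open>\<eta>\<close> becomes its factor.\<close>
  have "(LINT s|?M. \<eta> s \<bullet> h (min s T))
      = (LINT s|?M. indicator {0..T} s *\<^sub>R (\<eta> s \<bullet> h (min s T)) + (\<eta> s - indicator {0..T} s *\<^sub>R \<eta> s) \<bullet> h T)"
    by (rule Bochner_Integration.integral_cong) (auto simp: indicator_def space_restrict_space min_def)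
  also have "\<dots> = (LINT s|?M. indicator {0..T} s *\<^sub>R (\<eta> s \<bullet> h (min s T)))
      + ((LINT s|?M. \<eta> s) - (LINT s|?M. indicator {0..T} s *\<^sub>R \<eta> s)) \<bullet> h T"
    using i0 i1 \<eta>M by (simp del: real_scaleR_def)
  also have "(LINT s|?M. indicator {0..T} s *\<^sub>R (\<eta> s \<bullet> h (min s T))) = (LINT s|?L. \<eta> s \<bullet> h s)"
  proof -
    have "(LINT s|?M. indicator {0..T} s *\<^sub>R (\<eta> s \<bullet> h (min s T)))
        = (LINT s|lebesgue. indicator {0..} s *\<^sub>R indicator {0..T} s *\<^sub>R (\<eta> s \<bullet> h (min s T)))"
      by (rule integral_restrict_space) auto
    also have "\<dots> = (LINT s|lebesgue. indicator {0..T} s *\<^sub>R (\<eta> s \<bullet> h s))"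
      by (rule Bochner_Integration.integral_cong) (auto simp: indicator_def min_def)
    also have "\<dots> = (LINT s|?L. \<eta> s \<bullet> h s)"
      by (rule integral_restrict_space[symmetric]) auto
    finally show ?thesis .
  qed
  also have "(LINT s|?M. indicator {0..T} s *\<^sub>R \<eta> s) = (LINT s:{0..T}|lebesgue. \<eta> s)"
  proof -
    have "(LINT s|?M. indicator {0..T} s *\<^sub>R \<eta> s)
        = (LINT s|lebesgue. indicator {0..} s *\<^sub>R indicator {0..T} s *\<^sub>R \<eta> s)"
      by (rule integral_restrict_space) auto
    also have "\<dots> = (LINT s|lebesgue. indicator {0..T} s *\<^sub>R \<eta> s)"
      by (rule Bochner_Integration.integral_cong) (auto simp: indicator_def)
    finally show ?thesis unfolding set_lebesgue_integral_def .
  qed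
  finally have II: "(LINT s|?M. \<eta> s \<bullet> h (min s T)) = (LINT s|?L. \<eta> s \<bullet> h s)
      + ((LINT s|?M. \<eta> s) - (LINT s:{0..T}|lebesgue. \<eta> s)) \<bullet> h T" .
  show "integrable ?L (\<lambda>t. p t \<bullet> k t - \<eta> t \<bullet> h t)"
    by (intro Bochner_Integration.integrable_diff ipk \<eta>h)
  have "(LINT t|?L. p t \<bullet> k t - \<eta> t \<bullet> h t) = (LINT t|?L. p t \<bullet> k t) - (LINT t|?L. \<eta> t \<bullet> h t)"
    by (rule Bochner_Integration.integral_diff[OF ipk \<eta>h])
  also have "\<dots> = q \<bullet> h T - p 0 \<bullet> h 0
          + ((LINT s:{0..}|lebesgue. \<eta> s) - (LINT s:{0..T}|lebesgue. \<eta> s)) \<bullet> h T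
          - (\<Sum>j=1..l. LINT s|\<mu> j. \<Gamma> j s \<bullet> h (?\<sigma> s))"
    unfolding I II p0 \<eta>0
    by (simp add: inner_add_left inner_diff_left inner_diff_right inner_sum_left sum_subtractf)
  finally show "(LINT t|?L. p t \<bullet> k t - \<eta> t \<bullet> h t) = q \<bullet> h T - p 0 \<bullet> h 0
          + ((LINT s:{0..}|lebesgue. \<eta> s) - (LINT s:{0..T}|lebesgue. \<eta> s)) \<bullet> h T
          - (\<Sum>j=1..l. LINT s|\<mu> j. \<Gamma> j s \<bullet> h (?\<sigma> s))" .
qed

section \<open>Consequences of the hypotheses on the data\<close>

text \<open>The Hamiltonian at \<open>y\<close> dominates the Pontryagin function with control
  \<open>v\<close>, and at \<open>a\<close> the maximum condition makes it equal to the one with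
  control \<open>w\<close>. The tangent bound for concave functions compares the two values;
  separating dynamics from cost gives the claim.\<close>

lemma cost_difference_ge:
  fixes U :: "(real^'m) set"
    and f :: "real \<Rightarrow> real^'n \<Rightarrow> real^'m \<Rightarrow> real"
    and \<phi> :: "real \<Rightarrow> real^'n \<Rightarrow> real^'m \<Rightarrow> real^'n"
  assumes conc: "ereal_concave_on {x. norm (x - a) \<le> \<gamma>} (\<lambda>x. hamiltonian U \<omega> f \<phi> t x p)"
    and w: "w \<in> U" and v: "v \<in> U"
    and max: "\<forall>v\<in>U. pontryagin \<omega> f \<phi> t a v p 1 \<le> pontryagin \<omega> f \<phi> t a w p 1"
    and df: "((\<lambda>y. f t y w) has_derivative Df) (at a)"
    and d\<phi>: "((\<lambda>y. \<phi> t y w) has_derivative D\<phi>) (at a)"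
    and y: "norm (y - a) \<le> \<gamma>"
  shows "p \<bullet> (\<phi> t y v - \<phi> t a w) - pontryagin_x \<omega> f \<phi> t a w p 1 \<bullet> (y - a)
      \<le> \<omega> t * f t y v - \<omega> t * f t a w"
proof -
  let ?G = "\<lambda>y. pontryagin \<omega> f \<phi> t y w p 1"
  have touch: "hamiltonian U \<omega> f \<phi> t a p = ereal (?G a)"
    unfolding hamiltonian_def using w max by (intro antisym SUP_least SUP_upper2[of w]) auto
  have deriv: "(?G has_derivative (\<lambda>v. p \<bullet> D\<phi> v - \<omega> t * Df v)) (at a)"
    unfolding pontryagin_def by (auto intro!: derivative_eq_intros df d\<phi>)
  have "ereal (pontryagin \<omega> f \<phi> t y v p 1) \<le> hamiltonian U \<omega> f \<phi> t y p"
    unfolding hamiltonian_def using v by (rule SUP_upper)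
  also have "\<dots> \<le> ereal (?G a + (p \<bullet> D\<phi> (y - a) - \<omega> t * Df (y - a)))"
  proof (rule ereal_concave_on_le_derivative[where F = "\<lambda>x. hamiltonian U \<omega> f \<phi> t x p" and G = ?G
        and L = "\<lambda>v. p \<bullet> D\<phi> v - \<omega> t * Df v" and c = a and \<gamma> = \<gamma>, OF conc _ touch deriv y])
    show "ereal (?G x) \<le> hamiltonian U \<omega> f \<phi> t x p" for x
      unfolding hamiltonian_def using w by (rule SUP_upper)
  qed
  also have "p \<bullet> D\<phi> (y - a) - \<omega> t * Df (y - a) = pontryagin_x \<omega> f \<phi> t a w p 1 \<bullet> (y - a)"
    unfolding pontryagin_x_def by (rule inner_gradient[OF deriv, symmetric])
  finally show ?thesis
    by (simp add: pontryagin_def inner_diff_right)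
qed

text \<open>This is the concave tangent bound for \<open>- g\<close>, which serves as its own
  minorant.\<close>

lemma convex_on_gradient_ineq:
  fixes g :: "'a::euclidean_space \<Rightarrow> real"
  assumes conv: "convex_on {x. norm (x - a) \<le> \<gamma>} g" and d: "(g has_derivative D) (at a)"
    and y: "norm (y - a) \<le> \<gamma>"
  shows "gradient g a \<bullet> (y - a) \<le> g y - g a"
proof -
  have "ereal_concave_on {x. norm (x - a) \<le> \<gamma>} (\<lambda>x. ereal (- g x))"
    unfolding ereal_concave_on_def
  proof (intro conjI ballI allI impI)
    show "convex {x. norm (x - a) \<le> \<gamma>}"
      using conv by (rule convex_on_imp_convex)
    fix x z and b c :: real
    assume "x \<in> {x. norm (x - a) \<le> \<gamma>}" "z \<in> {x. norm (x - a) \<le> \<gamma>}" "0 \<le> b" "0 \<le> c" "b + c = 1"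
    then show "ereal b * ereal (- g x) + ereal c * ereal (- g z) \<le> ereal (- g (b *\<^sub>R x + c *\<^sub>R z))"
      using conv unfolding convex_on_def by fastforce
  qed
  then have "ereal (- g y) \<le> ereal (- g a + - D (y - a))"
    by (rule ereal_concave_on_le_derivative[where F = "\<lambda>x. ereal (- g x)" and G = "\<lambda>x. - g x"
          and L = "\<lambda>v. - D v", OF _ order_refl refl has_derivative_minus[OF d] y])
  then show ?thesis by (simp add: inner_gradient[OF d])
qed

text \<open>Uniform continuity of the \<open>x\<close>-derivative along the trajectory gives
  continuity and boundedness, which later make the gradient integrable against the finite
  multipliers.\<close>

lemma B_Lip_constraint_gradient:
  fixes f :: "real \<Rightarrow> real^'n \<Rightarrow> real^'m \<Rightarrow> real"
  assumes x: "x \<in> B_Lip f \<phi> l g" and cont: "continuous_on {0..} x" and j: "j \<in> {1..l}"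
  shows "0 \<le> t \<Longrightarrow> \<exists>D. (g j t has_derivative D) (at (x t))"
    and "continuous_on {0..} (\<lambda>t. gradient (g j t) (x t))"
    and "bounded ((\<lambda>t. gradient (g j t) (x t)) ` {0..})"
proof -
  have bd: "bounded (x ` {0..})" using x unfolding B_Lip_def W1_inf_def by blast
  \<comment> \<open>The constraints do not depend on the control, so one dummy control value
    suffices.\<close>
  have "compact {0 :: real^'m}" by simp
  then obtain \<gamma> where \<gamma>: "\<gamma> > 0"
    and C1: "ext_uniformly_C1x_on {(t,y,u). 0 \<le> t \<and> norm (y - x t) \<le> \<gamma> \<and> u \<in> {0 :: real^'m}} (\<lambda>t x u. g j t x)"
    using x j unfolding B_Lip_def Let_def by blast
  let ?S = "{(t,y,u). 0 \<le> t \<and> norm (y - x t) \<le> \<gamma> \<and> u \<in> {0 :: real^'m}}"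
  obtain h' where h': "\<forall>(t,y,u)\<in>?S. ((\<lambda>y. g j t y) has_derivative blinfun_apply (h' t y u)) (at y)"
    and uc: "ext_uniformly_continuous_on ?S h'"
    using C1 unfolding ext_uniformly_C1x_on_def by blast
  have S: "(t, x t, 0) \<in> ?S" if "0 \<le> t" for t using that \<gamma> by simp
  have d: "(g j t has_derivative blinfun_apply (h' t (x t) 0)) (at (x t))" if "0 \<le> t" for t
    using bspec[OF h' S[OF that]] by simp
  then show "0 \<le> t \<Longrightarrow> \<exists>D. (g j t has_derivative D) (at (x t))" by blast
  \<comment> \<open>\<open>R\<close> sends a functional to its Riesz vector; being bounded and
    linear, it carries both properties from the operator-valued derivative to the gradient.\<close>
  define R where "R B = (\<Sum>b\<in>Basis. blinfun_apply B b *\<^sub>R b)" for B :: "(real^'n) \<Rightarrow>\<^sub>L real"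
  have R: "gradient (g j t) (x t) = R (h' t (x t) 0)" if "0 \<le> t" for t
    unfolding R_def using inner_gradient[OF d[OF that]]
    by (metis (mono_tags, lifting) euclidean_representation sum.cong)
  have R_lin: "bounded_linear R" unfolding R_def
    by (intro bounded_linear_sum bounded_linear_scaleR_const blinfun.bounded_linear_left)
  note along = ext_uniformly_continuous_on_along[OF uc S cont bd]
  have "continuous_on {0..} (\<lambda>t. R (h' t (x t) 0))"
    by (intro bounded_linear.continuous_on[OF R_lin] along)
  then show "continuous_on {0..} (\<lambda>t. gradient (g j t) (x t))"
    by (rule continuous_on_cong[THEN iffD1, rotated 2]) (auto simp: R)
  have "bounded (R ` (\<lambda>t. h' t (x t) 0) ` {0..})"
    by (intro bounded_linear_image R_lin along)
  then show "bounded ((\<lambda>t. gradient (g j t) (x t)) ` {0..})"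
    by (rule bounded_subset) (auto simp: R)
qed

text \<open>Differentiability concerns one time and one control value, so the compact control set
  can be \<open>{w}\<close>, with a radius depending on \<open>w\<close>.\<close>

lemma B_Lip_derivatives:
  fixes f :: "real \<Rightarrow> real^'n \<Rightarrow> real^'m \<Rightarrow> real"
  assumes x: "x \<in> B_Lip f \<phi> l g" and t: "0 \<le> t"
  shows "\<exists>D. ((\<lambda>y. f t y w) has_derivative D) (at (x t))"
    and "\<exists>D. ((\<lambda>y. \<phi> t y w) has_derivative D) (at (x t))"
proof -
  have "compact {w}" by simp
  then obtain \<gamma> where \<gamma>: "\<gamma> > 0"
    and C1: "ext_uniformly_C1x_on {(t,y,u). 0 \<le> t \<and> norm (y - x t) \<le> \<gamma> \<and> u \<in> {w}} f"
      "ext_uniformly_C1x_on {(t,y,u). 0 \<le> t \<and> norm (y - x t) \<le> \<gamma> \<and> u \<in> {w}} \<phi>"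
    using x unfolding B_Lip_def Let_def by blast
  let ?S = "{(t,y,u). 0 \<le> t \<and> norm (y - x t) \<le> \<gamma> \<and> u \<in> {w}}"
  have S: "(t, x t, w) \<in> ?S" using t \<gamma> by simp
  obtain f' where f': "\<forall>(t,y,u)\<in>?S. ((\<lambda>y. f t y u) has_derivative blinfun_apply (f' t y u)) (at y)"
    using C1(1) unfolding ext_uniformly_C1x_on_def by blast
  obtain \<phi>' where \<phi>': "\<forall>(t,y,u)\<in>?S. ((\<lambda>y. \<phi> t y u) has_derivative blinfun_apply (\<phi>' t y u)) (at y)"
    using C1(2) unfolding ext_uniformly_C1x_on_def by blast
  show "\<exists>D. ((\<lambda>y. f t y w) has_derivative D) (at (x t))"
    using bspec[OF f' S] by auto
  show "\<exists>D. ((\<lambda>y. \<phi> t y w) has_derivative D) (at (x t))"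
    using bspec[OF \<phi>' S] by auto
qed

section \<open>The state-constraint multipliers\<close>

text \<open>The point \<open>\<infinity>\<close> contributes one separate value, so the extension
  stays Borel and bounded whether or not the limit exists.\<close>

lemma integrable_ext_value:
  fixes G :: "real \<Rightarrow> 'a::euclidean_space"
  assumes M: "finite_measure M" "sets M = sets borel"
    and G: "continuous_on {0..} G" "bounded (G ` {0..})"
  shows "integrable M (ext_value G)"
proof -
  interpret finite_measure M by fact
  obtain B where B: "\<And>t. 0 \<le> t \<Longrightarrow> norm (G t) \<le> B"
    using G(2) unfolding bounded_iff by auto
  \<comment> \<open>Extending \<open>G\<close> by its value at \<open>0\<close> to negative times
    gives a function continuous on the whole line, hence Borel.\<close>
  have "continuous_on UNIV (\<lambda>t. G (max 0 t))"
    by (rule continuous_on_compose2[OF G(1)]) (auto intro!: continuous_intros)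
  then have [measurable]: "(\<lambda>t. G (max 0 t)) \<in> borel_measurable borel"
    by (rule borel_measurable_continuous_onI)
  have "(\<lambda>s. if s = \<infinity> then Lim at_top G else G (max 0 (enn2real s))) \<in> borel_measurable borel"
    by measurable
  then have "ext_value G \<in> borel_measurable borel"
    by (rule measurable_cong[THEN iffD1, rotated]) (simp add: ext_value_def max_def)
  then have "ext_value G \<in> borel_measurable M"
    by (simp add: measurable_cong_sets[OF M(2) refl])
  moreover have "norm (ext_value G s) \<le> max B (norm (Lim at_top G))" for s
    using B[of "enn2real s"] by (auto simp: ext_value_def)
  ultimately show ?thesis
    by (intro integrable_const_bound) auto
qed

text \<open>An atom of the multiplier at \<open>\<infinity>\<close> is controlled through the values of the constraint at
  finite times \<open>T\<close>, because \<open>h\<close> need not converge.\<close>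

lemma multiplier_inner_limsup:
  fixes G h :: "real \<Rightarrow> 'a::euclidean_space" and M :: "ennreal measure"
  assumes M: "finite_measure M" "sets M = sets borel"
    and G: "\<And>t. 0 \<le> t \<Longrightarrow> norm (G t) \<le> K"
    and h: "\<And>t. 0 \<le> t \<Longrightarrow> norm (h t) \<le> B"
    and int: "\<And>T. 0 \<le> T \<Longrightarrow> integrable M (\<lambda>s. ext_value G s \<bullet> h (enn2real (min s (ennreal T))))"
    and fin: "AE s in M. s \<noteq> \<infinity> \<longrightarrow> G (enn2real s) \<bullet> h (enn2real s) \<le> 0"
    and inf: "emeasure M {\<infinity>} > 0 \<Longrightarrow> \<exists>e. (e \<longlongrightarrow> 0) at_top \<and> (\<forall>T\<ge>0. Lim at_top G \<bullet> h T \<le> e T)"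
  obtains W where "(W \<longlongrightarrow> 0) at_top"
    "\<And>T. 0 \<le> T \<Longrightarrow> (LINT s|M. ext_value G s \<bullet> h (enn2real (min s (ennreal T)))) \<le> W T"
proof -
  interpret finite_measure M by fact
  have K: "0 \<le> K" and B: "0 \<le> B" using G[of 0] h[of 0] norm_ge_zero order_trans by blast+
  have [measurable_cong]: "sets M = sets borel" by (rule M(2))
  \<comment> \<open>Without an atom the point \<open>\<infinity>\<close> is null and
    \<open>e = 0\<close> serves; with one, \<open>inf\<close> supplies \<open>e\<close>.\<close>
  have "\<exists>e. (e \<longlongrightarrow> 0) at_top \<and> (\<forall>T\<ge>0. AE s in M. s = \<infinity> \<longrightarrow> Lim at_top G \<bullet> h T \<le> e T)"
  proof (cases "emeasure M {\<infinity>} > 0")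
    case True
    then show ?thesis using inf by (auto intro: AE_I2)
  next
    case False
    then have "{\<infinity>} \<in> null_sets M" by (simp add: null_setsI M(2))
    then have "AE s in M. s \<notin> {\<infinity>}" by (rule AE_not_in)
    then have "AE s in M. s = \<infinity> \<longrightarrow> Lim at_top G \<bullet> h T \<le> 0" for T
      by (rule eventually_mono) simp
    then show ?thesis by (intro exI[of _ "\<lambda>_. 0"]) simp
  qed
  then obtain e where e: "(e \<longlongrightarrow> 0) at_top"
      "\<And>T. 0 \<le> T \<Longrightarrow> AE s in M. s = \<infinity> \<longrightarrow> Lim at_top G \<bullet> h T \<le> e T"
    by blast
  \<comment> \<open>The first term covers the atom, the second the finite times after
    \<open>T\<close>, where the integrand is bounded by \<open>K * B\<close>; up to \<open>T\<close>
    it is nonpositive by \<open>fin\<close>.\<close>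
  define W where "W T = e T * measure M {\<infinity>} + K * B * measure M {ennreal T<..<\<infinity>}" for T
  have ind: "integrable M (indicator S :: _ \<Rightarrow> real)" "(LINT s|M. indicator S s) = measure M S"
    if "S \<in> sets borel" for S
    using that M(2) by (auto simp: emeasure_finite less_top[symmetric])
  show thesis
  proof
    \<comment> \<open>Every finite time leaves \<open>{ennreal T<..<\<infinity>}\<close> once
      \<open>T\<close> passes it, and \<open>\<infinity>\<close> never belongs to it.\<close>
    have "((\<lambda>T. LINT s|M. indicator {ennreal T<..<\<infinity>} s) \<longlongrightarrow> (LINT s|M. 0 :: real)) at_top"
    proof (rule integral_dominated_convergence_at_top[where w = "\<lambda>_. 1"])
      show "AE s in M. ((\<lambda>T. indicator {ennreal T<..<\<infinity>} s) \<longlongrightarrow> (0 :: real)) at_top"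
      proof (rule AE_I2)
        fix s :: ennreal
        have "\<forall>\<^sub>F T in at_top. indicator {ennreal T<..<\<infinity>} s = (0 :: real)"
          using eventually_ge_at_top[of "enn2real s"]
          by eventually_elim (cases s; auto simp: indicator_def ennreal_less_iff not_less)
        then show "((\<lambda>T. indicator {ennreal T<..<\<infinity>} s) \<longlongrightarrow> (0 :: real)) at_top"
          by (rule tendsto_eventually)
      qed
    qed (auto simp: indicator_def)
    then have "((\<lambda>T. measure M {ennreal T<..<\<infinity>}) \<longlongrightarrow> 0) at_top"
      by (simp add: ind)
    then have "(W \<longlongrightarrow> 0 * measure M {\<infinity>} + K * B * 0) at_top"
      unfolding W_def by (intro tendsto_intros e)
    then show "(W \<longlongrightarrow> 0) at_top" by simp
    fix T :: real assume T: "0 \<le> T"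
    let ?\<sigma> = "\<lambda>s. enn2real (min s (ennreal T))"
    let ?w = "\<lambda>s. e T * indicator {\<infinity>} s + K * B * indicator {ennreal T<..<\<infinity>} s"
    have "(LINT s|M. ext_value G s \<bullet> h (?\<sigma> s)) \<le> (LINT s|M. ?w s)"
    proof (rule integral_mono_AE)
      show "integrable M ?w"
        by (intro Bochner_Integration.integrable_add integrable_mult_right ind) auto
      show "AE s in M. ext_value G s \<bullet> h (?\<sigma> s) \<le> ?w s"
        using fin e(2)[OF T]
      proof eventually_elim
        case (elim s)
        consider "s = \<infinity>" | "s \<noteq> \<infinity>" "s \<le> ennreal T" | "s \<noteq> \<infinity>" "ennreal T < s" by fastforce
        then show ?case
        proof cases
          case 1
          then show ?thesis using elim T by (simp add: ext_value_def)
        next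
          case 2
          then show ?thesis using elim by (auto simp: ext_value_def min_absorb1 indicator_def dest: leD)
        next
          case 3
          have "G (enn2real s) \<bullet> h T \<le> norm (G (enn2real s)) * norm (h T)"
            by (rule norm_cauchy_schwarz)
          also have "\<dots> \<le> K * B" using K by (intro mult_mono G h T) auto
          finally show ?thesis using 3 T by (auto simp: ext_value_def min_absorb2 less_top)
        qed
      qed
    qed (rule int[OF T])
    also have "\<dots> = W T"
    proof -
      have "integrable M (\<lambda>s. e T * indicator {\<infinity>} s :: real)"
        "integrable M (\<lambda>s. K * B * indicator {ennreal T<..<\<infinity>} s :: real)"
        by (intro integrable_mult_right ind; auto)+
      then show ?thesis
        unfolding W_def by (subst Bochner_Integration.integral_add) (auto simp: ind)
    qed
    finally show "(LINT s|M. ext_value G s \<bullet> h (?\<sigma> s)) \<le> W T" .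
  qed
qed

section \<open>Sufficiency\<close>

theorem theorem4p3:
  fixes U :: "(real^'m) set"
    and \<omega> :: "real \<Rightarrow> real"
    and f :: "real \<Rightarrow> real^'n \<Rightarrow> real^'m \<Rightarrow> real"
    and \<phi> :: "real \<Rightarrow> real^'n \<Rightarrow> real^'m \<Rightarrow> real^'n"
    and l :: nat
    and g :: "nat \<Rightarrow> real \<Rightarrow> real^'n \<Rightarrow> real"
    and I0 I1 :: "'n set"
    and x0 x1 :: "real^'n"
    and xs :: "real \<Rightarrow> real^'n"
    and us :: "real \<Rightarrow> real^'m"
    and p :: "real \<Rightarrow> real^'n"
    and \<mu> :: "nat \<Rightarrow> ennreal measure"
    and q :: "real^'n"
    and \<gamma> :: real
  assumes "U \<noteq> {}"
    and "set_integrable lebesgue {0..} \<omega>" and "\<forall>t\<ge>0. \<omega> t \<ge> 0"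
    and "QS_admissible U \<omega> f \<phi> l g I0 I1 x0 x1 xs us"
    and "xs \<in> B_Lip f \<phi> l g"
    and "piecewise_C1 p"
    \<comment> \<open>(a)\<close>
    and "bounded_variation_on {0..} p"
    and "\<forall>j\<in>{1..l}. finite_regular_borel_measure (\<mu> j)"
    and "\<forall>j\<in>{1..l}. AE s in \<mu> j. s \<in> active_set (g j) xs"
    and "\<forall>j\<in>{1..l}. emeasure (\<mu> j) {\<infinity>} > 0
           \<longrightarrow> (\<exists>L. ((\<lambda>t. gradient (g j t) (xs t)) \<longlongrightarrow> L) at_top)"
    and "\<forall>i. i \<notin> I1 \<longrightarrow> q $ i = 0"
    and "set_integrable lebesgue {0..} (\<lambda>s. pontryagin_x \<omega> f \<phi> s (xs s) (us s) (p s) 1)"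
    and "\<forall>t\<ge>0. p t = q
           + (LINT s:{t..}|lebesgue. pontryagin_x \<omega> f \<phi> s (xs s) (us s) (p s) 1)
           - (\<Sum>j=1..l. LINT s:{ennreal t..}|\<mu> j. ext_value (\<lambda>r. gradient (g j r) (xs r)) s)"
    and "\<forall>i. i \<notin> I0 \<longrightarrow> p 0 $ i = 0"
    and "AE t in lebesgue_on {0..}. \<forall>v\<in>U.
           pontryagin \<omega> f \<phi> t (xs t) v (p t) 1 \<le> pontryagin \<omega> f \<phi> t (xs t) (us t) (p t) 1"
    \<comment> \<open>(b)\<close>
    and "\<gamma> > 0"
    and "\<forall>t\<ge>0. ereal_concave_on {x. norm (x - xs t) \<le> \<gamma>} (\<lambda>x. hamiltonian U \<omega> f \<phi> t x (p t))"
    and "\<forall>t\<ge>0. \<forall>j\<in>{1..l}. convex_on {x. norm (x - xs t) \<le> \<gamma>} (g j t)"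
  shows "QS_strong_local_minimum U \<omega> f \<phi> l g I0 I1 x0 x1 xs us"
proof -

  \<comment> \<open>Standing facts on the multipliers and the constraint gradients\<close>
  note adm_s = assms(4) and xs_Lip = assms(5)
  let ?\<eta> = "\<lambda>s. pontryagin_x \<omega> f \<phi> s (xs s) (us s) (p s) 1"
  let ?G = "\<lambda>j t. gradient (g j t) (xs t)"
  note \<mu>_reg = assms(8)[rule_format, unfolded finite_regular_borel_measure_def]
  have \<mu>: "finite_measure (\<mu> j)" "sets (\<mu> j) = sets borel" if "j \<in> {1..l}" for j
    using \<mu>_reg[OF that] by blast+
  have xs_W: "xs \<in> W1_inf" using adm_s unfolding QS_admissible_def by blast
  have xs_cont: "continuous_on {0..} xs" by (rule W1_inf_continuous_on[OF xs_W])
  note Ggrad = B_Lip_constraint_gradient[OF xs_Lip xs_cont]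
  have \<Gamma>: "integrable (\<mu> j) (ext_value (?G j))" if "j \<in> {1..l}" for j
    using integrable_ext_value[OF \<mu>[OF that] Ggrad(2,3)[OF that]] .
  \<comment> \<open>The radius \<open>\<gamma>\<close> of the concavity and convexity tube also
    serves as the neighbourhood of the strong minimum.\<close>
  have "QS_cost \<omega> f xs us \<le> QS_cost \<omega> f x u"
    if adm: "QS_admissible U \<omega> f \<phi> l g I0 I1 x0 x1 x u" and near: "sup_norm (\<lambda>t. x t - xs t) \<le> \<gamma>" for x u
  proof -

    \<comment> \<open>The deviation from the reference trajectory\<close>
    have x_W: "x \<in> W1_inf" using adm unfolding QS_admissible_def by blast
    define h where "h t = x t - xs t" for t
    have h_le: "norm (h t) \<le> \<gamma>" if t: "0 \<le> t" for t
    proof -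
      \<comment> \<open>A real supremum is sure to bound its terms only when the set is bounded
        above; boundedness of both trajectories ensures this.\<close>
      obtain B1 B2 where "\<And>t. 0 \<le> t \<Longrightarrow> norm (x t) \<le> B1" "\<And>t. 0 \<le> t \<Longrightarrow> norm (xs t) \<le> B2"
        using x_W xs_W unfolding W1_inf_def bounded_iff by auto
      then have "bdd_above ((\<lambda>t. norm (x t - xs t)) ` {0..})"
        by (intro bdd_aboveI2[where M = "B1 + B2"]) (force intro: norm_triangle_le_diff add_mono)
      then have "norm (x t - xs t) \<le> sup_norm (\<lambda>t. x t - xs t)"
        unfolding sup_norm_def using t by (intro cSUP_upper) auto
      then show ?thesis using near by (simp add: h_def)
    qed
    obtain k C where k: "\<And>t. norm (k t) \<le> C"
      "AE t in lebesgue_on {0..}. ((\<lambda>t. x t - xs t) has_vector_derivative k t) (at t)"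
      "\<And>T. 0 \<le> T \<Longrightarrow> (k has_integral (x T - xs T) - (x 0 - xs 0)) {0..T}"
      by (rule W1_inf_diff_derivative[OF x_W xs_W]) (rule that)
    have k_int: "(k has_integral h t - h 0) {0..t}" if "0 \<le> t" for t
      using k(3)[OF that] by (simp add: h_def)
    note k_props = bounded_primitive_measurable_integral[OF k(1) k_int]

    \<comment> \<open>Pointwise comparison of the cost densities\<close>
    define \<Delta> where "\<Delta> t = \<omega> t * f t (x t) (u t) - \<omega> t * f t (xs t) (us t)" for t
    have us_U: "us t \<in> U" and u_U: "u t \<in> U" if "0 \<le> t" for t
      using adm adm_s that unfolding QS_admissible_def L_inf_def by blast+
    have x': "AE t in lebesgue_on {0..}. (x has_vector_derivative \<phi> t (x t) (u t)) (at t)"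
      and xs': "AE t in lebesgue_on {0..}. (xs has_vector_derivative \<phi> t (xs t) (us t)) (at t)"
      using adm adm_s unfolding QS_admissible_def by blast+
    have "AE t in lebesgue_on {0..}. p t \<bullet> k t - ?\<eta> t \<bullet> h t \<le> \<Delta> t"
      using x' xs' k(2) assms(15) AE_space
    proof eventually_elim
      case (elim t)
      then have t: "0 \<le> t" by (simp add: space_restrict_space)
      have kt: "k t = \<phi> t (x t) (u t) - \<phi> t (xs t) (us t)"
        using vector_derivative_unique_at[OF elim(3) has_vector_derivative_diff[OF elim(1,2)]] .
      obtain Df D\<phi> where D: "((\<lambda>y. f t y (us t)) has_derivative Df) (at (xs t))"
        "((\<lambda>y. \<phi> t y (us t)) has_derivative D\<phi>) (at (xs t))"
        using B_Lip_derivatives[OF xs_Lip t] by blast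
      have "norm (x t - xs t) \<le> \<gamma>" using h_le[OF t] by (simp add: h_def)
      then show ?case
        using cost_difference_ge[OF assms(17)[rule_format, OF t] us_U[OF t] u_U[OF t] elim(4) D]
        by (simp add: kt h_def \<Delta>_def)
    qed
    then have ineq: "AE t in lebesgue. 0 \<le> t \<longrightarrow> p t \<bullet> k t - ?\<eta> t \<bullet> h t \<le> \<Delta> t"
      by (simp add: AE_restrict_space_iff)

    have \<Delta>_int: "set_integrable lebesgue {0..} \<Delta>"
      and \<Delta>_cost: "(LINT t:{0..}|lebesgue. \<Delta> t) = QS_cost \<omega> f x u - QS_cost \<omega> f xs us"
    proof -
      have "set_integrable lebesgue {0..} (\<lambda>t. \<omega> t * f t (x t) (u t))"
        "set_integrable lebesgue {0..} (\<lambda>t. \<omega> t * f t (xs t) (us t))"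
        using adm adm_s unfolding QS_admissible_def by blast+
      from set_integral_diff[OF this] show "set_integrable lebesgue {0..} \<Delta>"
        "(LINT t:{0..}|lebesgue. \<Delta> t) = QS_cost \<omega> f x u - QS_cost \<omega> f xs us"
        unfolding \<Delta>_def QS_cost_def by simp_all
    qed

    \<comment> \<open>Integration by parts over \<open>{0..T}\<close>\<close>
    have parts_int: "0 \<le> T \<Longrightarrow> integrable (lebesgue_on {0..T}) (\<lambda>t. p t \<bullet> k t - ?\<eta> t \<bullet> h t)"
      and parts: "0 \<le> T \<Longrightarrow> (LINT t|lebesgue_on {0..T}. p t \<bullet> k t - ?\<eta> t \<bullet> h t)
        = q \<bullet> h T - p 0 \<bullet> h 0
          + ((LINT s:{0..}|lebesgue. ?\<eta> s) - (LINT s:{0..T}|lebesgue. ?\<eta> s)) \<bullet> h T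
          - (\<Sum>j=1..l. LINT s|\<mu> j. ext_value (?G j) s \<bullet> h (enn2real (min s (ennreal T))))"
      and mult_int: "0 \<le> T \<Longrightarrow> j \<in> {1..l} \<Longrightarrow>
        integrable (\<mu> j) (\<lambda>s. ext_value (?G j) s \<bullet> h (enn2real (min s (ennreal T))))" for T j
      using integrable_adjoint_inner[OF k_props(1) k(1) k_props(2) _ assms(12) \<mu> \<Gamma> assms(13)[rule_format]]
        integral_adjoint_inner[OF k_props(1) k(1) k_props(2) _ assms(12) \<mu> \<Gamma> assms(13)[rule_format]]
        integrable_multiplier_inner[OF k_props(1) k(1) k_props(2) _ assms(12) \<mu> \<Gamma> assms(13)[rule_format]]
      by blast+

    \<comment> \<open>Asymptotic upper bounds for the multiplier terms\<close>
    have W_ex: "\<exists>W. (W \<longlongrightarrow> 0) at_top \<and>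
        (\<forall>T\<ge>0. (LINT s|\<mu> j. ext_value (?G j) s \<bullet> h (enn2real (min s (ennreal T)))) \<le> W T)"
      if j: "j \<in> {1..l}" for j
    proof -
      obtain K where K: "\<And>t. 0 \<le> t \<Longrightarrow> norm (?G j t) \<le> K"
        using Ggrad(3)[OF j] unfolding bounded_iff by auto
      \<comment> \<open>Convexity bounds the tangent increment by the difference of the constraint
        values, and admissibility of \<open>x\<close> makes the first of them nonpositive.\<close>
      have tangent: "?G j t \<bullet> h t \<le> - g j t (xs t)" if t: "0 \<le> t" for t
      proof -
        obtain D where D: "(g j t has_derivative D) (at (xs t))" using Ggrad(1)[OF j t] by blast
        have "?G j t \<bullet> (x t - xs t) \<le> g j t (x t) - g j t (xs t)"
          using h_le[OF t] assms(18) t j by (intro convex_on_gradient_ineq[OF _ D]) (auto simp: h_def)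
        moreover have "g j t (x t) \<le> 0" using adm j t unfolding QS_admissible_def by blast
        ultimately show ?thesis by (simp add: h_def)
      qed
      have fin: "AE s in \<mu> j. s \<noteq> \<infinity> \<longrightarrow> ?G j (enn2real s) \<bullet> h (enn2real s) \<le> 0"
        using assms(9)[rule_format, OF j]
      proof eventually_elim
        case (elim s)
        then show ?case using tangent[of "enn2real s"] by (auto simp: active_set_def)
      qed
      \<comment> \<open>\<open>tangent\<close> involves the gradient at a finite time rather than
        its limit \<open>L\<close>; exchanging them costs
        \<open>norm (L - ?G j t) * \<gamma>\<close>. This error and the constraint value along
        \<open>xs\<close> both tend to \<open>0\<close>, the latter because an atom at
        \<open>\<infinity>\<close> forces \<open>\<infinity>\<close> to be active.\<close>
      have inf: "\<exists>e. (e \<longlongrightarrow> 0) at_top \<and> (\<forall>T\<ge>0. Lim at_top (?G j) \<bullet> h T \<le> e T)"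
        if atom: "emeasure (\<mu> j) {\<infinity>} > 0"
      proof -
        have "\<infinity> \<in> active_set (g j) xs"
        proof (rule ccontr)
          assume "\<infinity> \<notin> active_set (g j) xs"
          then have "AE s in \<mu> j. s \<notin> {\<infinity>}"
            using assms(9)[rule_format, OF j] by (auto elim: eventually_mono)
          then have "emeasure (\<mu> j) {\<infinity>} = 0"
            using \<mu>(2)[OF j] by (subst (asm) AE_iff_measurable[where N = "{\<infinity>}"])
              (auto simp: sets_eq_imp_space_eq)
          then show False using atom by simp
        qed
        then have g0: "((\<lambda>t. g j t (xs t)) \<longlongrightarrow> 0) at_top" by (simp add: active_set_def)
        obtain L where L: "(?G j \<longlongrightarrow> L) at_top" using assms(10) j atom by blast
        then have Lim: "Lim at_top (?G j) = L" by (intro tendsto_Lim) auto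
        let ?e = "\<lambda>t. norm (L - ?G j t) * \<gamma> - g j t (xs t)"
        have "(?e \<longlongrightarrow> norm (L - L) * \<gamma> - 0) at_top"
          by (intro tendsto_intros L g0)
        moreover have "L \<bullet> h t \<le> ?e t" if t: "0 \<le> t" for t
        proof -
          have "L \<bullet> h t = (L - ?G j t) \<bullet> h t + ?G j t \<bullet> h t" by (simp add: inner_diff_left)
          also have "(L - ?G j t) \<bullet> h t \<le> norm (L - ?G j t) * norm (h t)" by (rule norm_cauchy_schwarz)
          also have "\<dots> \<le> norm (L - ?G j t) * \<gamma>" by (intro mult_left_mono h_le t) auto
          finally show ?thesis using tangent[OF t] by linarith
        qed
        ultimately show ?thesis by (intro exI[of _ ?e]) (simp add: Lim)
      qed
      show ?thesis
        using multiplier_inner_limsup[OF \<mu>[OF j] K h_le mult_int[OF _ j] fin inf] by metis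
    qed
    have "\<exists>W. \<forall>j\<in>{1..l}. (W j \<longlongrightarrow> 0) at_top \<and>
        (\<forall>T\<ge>0. (LINT s|\<mu> j. ext_value (?G j) s \<bullet> h (enn2real (min s (ennreal T)))) \<le> W j T)"
      by (intro bchoice ballI W_ex)
    then obtain W where W: "\<And>j. j \<in> {1..l} \<Longrightarrow> (W j \<longlongrightarrow> 0) at_top"
      "\<And>j T. j \<in> {1..l} \<Longrightarrow> 0 \<le> T \<Longrightarrow>
        (LINT s|\<mu> j. ext_value (?G j) s \<bullet> h (enn2real (min s (ennreal T)))) \<le> W j T"
      by blast

    \<comment> \<open>Passage to the limit as \<open>T\<close> tends to infinity\<close>
    define R where "R T = q \<bullet> h T
      + ((LINT s:{0..}|lebesgue. ?\<eta> s) - (LINT s:{0..T}|lebesgue. ?\<eta> s)) \<bullet> h T - (\<Sum>j=1..l. W j T)" for T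
    \<comment> \<open>On prescribed components both trajectories start at the same value; on the
      free ones \<open>p 0\<close> vanishes by transversality.\<close>
    have p0h0: "p 0 \<bullet> h 0 = 0"
    proof -
      have "p 0 $ i * h 0 $ i = 0" for i
        using assms(14) adm adm_s unfolding QS_admissible_def h_def by (cases "i \<in> I0") auto
      then show ?thesis by (auto simp: inner_vec_def intro: sum.neutral)
    qed
    \<comment> \<open>The multiplier integrals enter with a minus sign, so their upper bounds
      \<open>W\<close> produce a lower bound.\<close>
    have R_le: "R T \<le> (LINT t:{0..T}|lebesgue. \<Delta> t)" if T: "0 \<le> T" for T
    proof -
      have "R T \<le> (LINT t|lebesgue_on {0..T}. p t \<bullet> k t - ?\<eta> t \<bullet> h t)"
        unfolding R_def parts[OF T] p0h0 using W(2) T by (auto intro!: sum_mono)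
      also have "\<dots> \<le> (LINT t|lebesgue_on {0..T}. \<Delta> t)"
      proof (rule integral_mono_AE[OF parts_int[OF T]])
        have "set_integrable lebesgue {0..T} \<Delta>"
          by (rule set_integrable_subset[OF \<Delta>_int]) auto
        then show "integrable (lebesgue_on {0..T}) \<Delta>"
          unfolding set_integrable_def by (subst integrable_restrict_space) auto
        have "AE t in lebesgue. t \<in> {0..T} \<longrightarrow> p t \<bullet> k t - ?\<eta> t \<bullet> h t \<le> \<Delta> t"
          using ineq by (rule eventually_mono) simp
        then show "AE t in lebesgue_on {0..T}. p t \<bullet> k t - ?\<eta> t \<bullet> h t \<le> \<Delta> t"
          by (simp add: AE_restrict_space_iff)
      qed
      also have "\<dots> = (LINT t:{0..T}|lebesgue. \<Delta> t)"
        unfolding set_lebesgue_integral_def by (rule integral_restrict_space) auto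
      finally show ?thesis .
    qed
    \<comment> \<open>On components in \<open>I1\<close> both trajectories have the same limit; on
      the others \<open>q\<close> vanishes.\<close>
    have qh: "((\<lambda>T. q \<bullet> h T) \<longlongrightarrow> 0) at_top"
    proof -
      have "((\<lambda>T. q $ i * h T $ i) \<longlongrightarrow> 0) at_top" for i
      proof (cases "i \<in> I1")
        case True
        then have "((\<lambda>t. x t $ i) \<longlongrightarrow> x1 $ i) at_top" "((\<lambda>t. xs t $ i) \<longlongrightarrow> x1 $ i) at_top"
          using adm adm_s unfolding QS_admissible_def by blast+
        then have "((\<lambda>T. q $ i * (x T $ i - xs T $ i)) \<longlongrightarrow> q $ i * (x1 $ i - x1 $ i)) at_top"
          by (intro tendsto_mult tendsto_diff tendsto_const)
        then show ?thesis by (simp add: h_def)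
      next
        case False
        then show ?thesis using assms(11) by simp
      qed
      then have "((\<lambda>T. \<Sum>i\<in>UNIV. q $ i * h T $ i) \<longlongrightarrow> (\<Sum>i\<in>(UNIV :: 'n set). 0)) at_top"
        by (intro tendsto_sum)
      then show ?thesis by (simp add: inner_vec_def)
    qed
    \<comment> \<open>\<open>h\<close> is bounded by \<open>\<gamma>\<close> but need not converge;
      the decay comes from the tail of the integrable gradient.\<close>
    have \<eta>h: "((\<lambda>T. ((LINT s:{0..}|lebesgue. ?\<eta> s) - (LINT s:{0..T}|lebesgue. ?\<eta> s)) \<bullet> h T) \<longlongrightarrow> 0) at_top"
      (is "((\<lambda>T. ?E T \<bullet> h T) \<longlongrightarrow> 0) at_top")
    proof (rule Lim_null_comparison)
      show "\<forall>\<^sub>F T in at_top. norm (?E T \<bullet> h T) \<le> norm (?E T) * \<gamma>"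
        using eventually_ge_at_top[of 0]
      proof eventually_elim
        case (elim T)
        have "norm (?E T \<bullet> h T) \<le> norm (?E T) * norm (h T)"
          using Cauchy_Schwarz_ineq2[of "?E T" "h T"] by simp
        also have "\<dots> \<le> norm (?E T) * \<gamma>" by (intro mult_left_mono h_le elim) auto
        finally show ?case .
      qed
      have "((\<lambda>T. LINT s:{0..T}|lebesgue. ?\<eta> s) \<longlongrightarrow> (LINT s:{0..}|lebesgue. ?\<eta> s)) at_top"
        by (rule tendsto_set_lebesgue_integral_at_top[OF _ assms(12)]) auto
      then have "((\<lambda>T. norm (?E T) * \<gamma>) \<longlongrightarrow>
          norm ((LINT s:{0..}|lebesgue. ?\<eta> s) - (LINT s:{0..}|lebesgue. ?\<eta> s)) * \<gamma>) at_top"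
        by (intro tendsto_intros)
      then show "((\<lambda>T. norm (?E T) * \<gamma>) \<longlongrightarrow> 0) at_top" by simp
    qed
    have "((\<lambda>T. \<Sum>j=1..l. W j T) \<longlongrightarrow> (\<Sum>j=1..l. 0)) at_top"
      by (intro tendsto_sum W)
    then have "(R \<longlongrightarrow> 0 + 0 - 0) at_top"
      unfolding R_def by (intro tendsto_diff tendsto_add qh \<eta>h) simp
    then have "(R \<longlongrightarrow> 0) at_top" by simp
    moreover have "((\<lambda>T. LINT t:{0..T}|lebesgue. \<Delta> t) \<longlongrightarrow> (LINT t:{0..}|lebesgue. \<Delta> t)) at_top"
      by (rule tendsto_set_lebesgue_integral_at_top[OF _ \<Delta>_int]) auto
    moreover have "\<forall>\<^sub>F T in at_top. R T \<le> (LINT t:{0..T}|lebesgue. \<Delta> t)"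
      using eventually_ge_at_top[of 0] by eventually_elim (rule R_le)
    ultimately have "0 \<le> (LINT t:{0..}|lebesgue. \<Delta> t)"
      by (intro tendsto_le[OF trivial_limit_at_top_linorder])
    then show ?thesis by (simp add: \<Delta>_cost)
  qed
  then show ?thesis
    unfolding QS_strong_local_minimum_def using adm_s assms(16) by blast
qed

end
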